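(* For every partition $\lambda$, $$G_\lambda=\sum_{\alpha:\ \lambda(\alpha)=\lambda}\mathcal{G}_\alpha ,$$ where the sum is over all compositions $\alpha$ whose parts rearrange to the (nonzero) parts of $\lambda$ (an identity of formal power series in $x_1,x_2,\dots$ with coefficients in $\mathbb{Z}[\beta]$).
   Context: $\beta$ is an indeterminate. A weak composition (resp. composition) is a finite sequence of nonnegative (resp. positive) integers; weak compositions differing only by trailing zeros are identified, and likewise for partitions. $|\gamma|=\sum_i\gamma_i$. A partition is a weak composition with weakly decreasing parts; $\lambda(\gamma)$ is the unique partition with the same parts as $\gamma$. For a weak composition $\gamma$, $\gamma^+$ is the composition obtained by dropping its zero parts. Skyline diagrams. The skyline diagram of $\gamma=(\gamma_1,\dots,\gamma_n)$ has left-justified rows numbered $1,\dots,n$ from top to bottom, with boxes $(i,j)$, $1\le j\le\gamma_i$, in row $i$, plus a basement box $(i,0)$ in each row containing the fixed value $b_i=i$. A set-valued filling assigns a nonempty finite set of positive integers to each non-basement box. The maximum of a box is its anchor entry; the other entries of the box are free entries. A basement box is treated as a box with the single (anchor) entry $i$. Triples, for rows $i<j$ and a column $k\ge0$. Type A (when $\gamma_i\ge\gamma_j$): the boxes $(i,k),(i,k+1),(j,k+1)$, with anchor entries $c,a,b$ respectively. Type B (when $\gamma_i<\gamma_j$): the boxes $(i,k),(j,k),(j,k+1)$, with anchor entries $b,c,a$ respectively. (All three boxes must exist; basement boxes are allowed.) A triple is an inversion triple if $b>c\ge a$ or $c\ge a>b$. A set-valued filling is semistandard if: (S1) entries do not repeat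 in a column; (S2) rows, including the basement, are weakly decreasing from left to right, where for sets $A\ge B$ means $\min A\ge\max B$; (S3) every triple of anchor entries (including basement boxes) is an inversion triple; (S4) every free entry is in the highest (lowest-numbered) row possible within its column: a free entry $x$ in column $j$ lies in the smallest-numbered row $i$ such that the box $(i,j)$ exists, $x$ is smaller than the anchor entry of $(i,j)$ (so $x$ is free there), and placing $x$ there does not violate (S2), i.e. $x$ is at least the anchor entry of $(i,j+1)$ if that box exists. $\mathsf{SetSkyFill}(\gamma)$ is the set of semistandard set-valued fillings of shape $\gamma$ with basement $b_i=i$. For such $F$, $|F|$ is the total number of entries (not counting the basement) and $x^F=\prod_i x_i^{m_i}$, where $m_i$ is the number of occurrences of $i$ in $F$ outside the basement. The combinatorial Lascoux atom is $$\mathcal{L}_\gamma=\sum_{F\in\mathsf{SetSkyFill}(\gamma)}\beta^{|F|-|\gamma|}x^F\in\mathbb{Z}[\beta][x_1,\dots,x_n].$$ For a composition $\alpha$, the quasisymmetric Grothendieck function is $\mathcal{G}_\alpha=\sum_{\gamma:\ \gamma^+=\alpha}\mathcal{L}_\gamma$, the sum over all weak compositions $\gamma$ with $\gamma^+=\alpha$. A set-valued reverse tableau of shape $\lambda$ is a filling of the Young diagram of $\lambda$ (English notation) by nonempty finite sets of positive integers such that rows are weakly decreasing from left to right ($\min A\ge\max B$ for $B$ immediately right of $A$) and columns are strictly decreasing from top to bottom ($\min A>\max B$ for $B$ immediately below $A$). $\mathsf{SetRT}(\lambda)$ is the set of these. For $T\in\mathsf{SetRT}(\lambda)$, $|T|$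 is the total number of entries, $x^T=\prod_i x_i^{\#\{i\text{'s in }T\}}$, and $G_\lambda=\sum_{T\in\mathsf{SetRT}(\lambda)}\beta^{|T|-|\lambda|}x^T$. *)

theory Defs
  imports "HOL-Library.Poly_Mapping" "HOL-Computational_Algebra.Polynomial"
begin

section \<open>Weak compositions, compositions, partitions\<close>

text \<open>
  A weak composition is a \<^typ>\<open>nat list\<close>. Rows are numbered from 1, and
  \<open>part \<gamma> i\<close> is 0 beyond the length of \<open>\<gamma>\<close>, so that trailing
  zeros have no influence. The identification of lists up to trailing zeros is
  \<open>trim \<gamma> = trim \<delta>\<close>; the lists with \<open>trim \<gamma> = \<gamma>\<close> form a system of
  representatives.
\<close>

definition part :: "nat list \<Rightarrow> nat \<Rightarrow> nat" where
  "part \<gamma> i = (if 1 \<le> i \<and> i \<le> length \<gamma> then \<gamma> ! (i - 1) else 0)"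

definition trim :: "nat list \<Rightarrow> nat list" where
  "trim \<gamma> = rev (dropWhile (\<lambda>a. a = 0) (rev \<gamma>))"

definition is_composition :: "nat list \<Rightarrow> bool" where
  "is_composition \<alpha> \<longleftrightarrow> (\<forall>a\<in>set \<alpha>. 0 < a)"

definition is_partition :: "nat list \<Rightarrow> bool" where
  "is_partition la \<longleftrightarrow> sorted_wrt (\<ge>) la"

definition sort_desc :: "nat list \<Rightarrow> nat list" where
  "sort_desc \<gamma> = rev (sort \<gamma>)"

definition positive_parts :: "nat list \<Rightarrow> nat list" where
  "positive_parts \<gamma> = filter (\<lambda>a. 0 < a) \<gamma>"


section \<open>Set-valued fillings and their weights\<close>

type_synonym filling = "nat \<times> nat \<Rightarrow> nat set"

definition boxes :: "nat list \<Rightarrow> (nat \<times> nat) set" where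
  "boxes \<gamma> = {(i, j). 1 \<le> i \<and> 1 \<le> j \<and> j \<le> part \<gamma> i}"

text \<open>Fillings are normalised to be empty outside the diagram, so that two fillings
  are equal as soon as they agree on all boxes.\<close>

definition set_filling :: "nat list \<Rightarrow> filling \<Rightarrow> bool" where
  "set_filling \<gamma> F \<longleftrightarrow>
     (\<forall>b\<in>boxes \<gamma>. finite (F b) \<and> F b \<noteq> {} \<and> (\<forall>x\<in>F b. 0 < x)) \<and>
     (\<forall>b. b \<notin> boxes \<gamma> \<longrightarrow> F b = {})"

definition num_entries :: "nat list \<Rightarrow> filling \<Rightarrow> nat" where
  "num_entries \<gamma> F = (\<Sum>b\<in>boxes \<gamma>. card (F b))"

text \<open>Monomials in \<open>x\<^sub>1, x\<^sub>2, \<dots>\<close> are represented by their exponent vectors;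
  the variable with index 0 never occurs, since entries are positive.\<close>

type_synonym monomial = "nat \<Rightarrow>\<^sub>0 nat"

definition weight :: "nat list \<Rightarrow> filling \<Rightarrow> monomial" where
  "weight \<gamma> F = (\<Sum>b\<in>boxes \<gamma>. \<Sum>i\<in>F b. Poly_Mapping.single i 1)"

definition \<beta> :: "int poly" where
  "\<beta> = [:0, 1:]"

text \<open>The exponent of \<open>\<beta>\<close> is not affected by truncated subtraction, because
  every box contains at least one entry (see \<open>size_le_num_entries\<close> below).\<close>

definition filling_term :: "nat list \<Rightarrow> filling \<Rightarrow> monomial \<Rightarrow>\<^sub>0 int poly" where
  "filling_term \<gamma> F =
     Poly_Mapping.single (weight \<gamma> F) (\<beta> ^ (num_entries \<gamma> F - sum_list \<gamma>))"


section \<open>Semistandard set-valued skyline fillings\<close>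

text \<open>Column 0 is the basement; its box in row \<open>i\<close> has the single entry \<open>i\<close>.\<close>

definition cell :: "filling \<Rightarrow> nat \<Rightarrow> nat \<Rightarrow> nat set" where
  "cell F i j = (if j = 0 then {i} else F (i, j))"

definition anchor :: "filling \<Rightarrow> nat \<Rightarrow> nat \<Rightarrow> nat" where
  "anchor F i j = Max (cell F i j)"

definition inversion :: "nat \<Rightarrow> nat \<Rightarrow> nat \<Rightarrow> bool" where
  "inversion a b c \<longleftrightarrow> (b > c \<and> c \<ge> a) \<or> (c \<ge> a \<and> a > b)"

definition column_distinct :: "nat list \<Rightarrow> filling \<Rightarrow> bool" where
  "column_distinct \<gamma> F \<longleftrightarrow>
     (\<forall>i i' j. (i, j) \<in> boxes \<gamma> \<longrightarrow> (i', j) \<in> boxes \<gamma> \<longrightarrow> i \<noteq> i' \<longrightarrow>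
        F (i, j) \<inter> F (i', j) = {})"

definition row_decreasing :: "nat list \<Rightarrow> filling \<Rightarrow> bool" where
  "row_decreasing \<gamma> F \<longleftrightarrow>
     (\<forall>i j. (i, Suc j) \<in> boxes \<gamma> \<longrightarrow> Min (cell F i j) \<ge> Max (cell F i (Suc j)))"

text \<open>The first conjunct covers the triples of type A, formed by the boxes
  \<open>(i, k), (i, k + 1), (j, k + 1)\<close>, the second one those of type B, formed by
  \<open>(i, k), (j, k), (j, k + 1)\<close>. The bounds on \<open>k\<close> make all three boxes exist (in type B,
  \<open>k + 1 \<le> part \<gamma> j\<close> follows). Rows beyond the length of \<open>\<gamma>\<close> have no boxes
  and contribute no triples.\<close>

definition triples_inversion :: "nat list \<Rightarrow> filling \<Rightarrow> bool" where
  "triples_inversion \<gamma> F \<longleftrightarrow>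
     (\<forall>i j k. 1 \<le> i \<longrightarrow> i < j \<longrightarrow> part \<gamma> i \<ge> part \<gamma> j \<longrightarrow> Suc k \<le> part \<gamma> j \<longrightarrow>
        inversion (anchor F i (Suc k)) (anchor F j (Suc k)) (anchor F i k)) \<and>
     (\<forall>i j k. 1 \<le> i \<longrightarrow> i < j \<longrightarrow> part \<gamma> i < part \<gamma> j \<longrightarrow> k \<le> part \<gamma> i \<longrightarrow>
        inversion (anchor F j (Suc k)) (anchor F i k) (anchor F j k))"

text \<open>That \<open>x\<close> does not exceed the entries to its left needs no separate condition: it
  is smaller than the anchor entry of its own box.\<close>

definition can_be_free :: "nat list \<Rightarrow> filling \<Rightarrow> nat \<Rightarrow> nat \<Rightarrow> nat \<Rightarrow> bool" where
  "can_be_free \<gamma> F x i j \<longleftrightarrow>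
     (i, j) \<in> boxes \<gamma> \<and> x < anchor F i j \<and>
     ((i, Suc j) \<in> boxes \<gamma> \<longrightarrow> x \<ge> anchor F i (Suc j))"

definition free_entries_highest :: "nat list \<Rightarrow> filling \<Rightarrow> bool" where
  "free_entries_highest \<gamma> F \<longleftrightarrow>
     (\<forall>i j x. (i, j) \<in> boxes \<gamma> \<longrightarrow> x \<in> F (i, j) \<longrightarrow> x \<noteq> anchor F i j \<longrightarrow>
        can_be_free \<gamma> F x i j \<and> (\<forall>r<i. \<not> can_be_free \<gamma> F x r j))"

definition SetSkyFill :: "nat list \<Rightarrow> filling set" where
  "SetSkyFill \<gamma> = {F. set_filling \<gamma> F \<and> column_distinct \<gamma> F \<and> row_decreasing \<gamma> F \<and>
     triples_inversion \<gamma> F \<and> free_entries_highest \<gamma> F}"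

definition lascoux_atom :: "nat list \<Rightarrow> monomial \<Rightarrow>\<^sub>0 int poly" where
  "lascoux_atom \<gamma> = (\<Sum>F\<in>SetSkyFill \<gamma>. filling_term \<gamma> F)"


section \<open>Formal power series\<close>

text \<open>A formal power series in \<open>x\<^sub>1, x\<^sub>2, \<dots>\<close> over \<open>\<int>[\<beta>]\<close> is given by its
  coefficient function. Infinite sums are taken coefficientwise; they make sense for
  families in which every monomial has only finitely many nonzero contributions. This is
  proved below for the two families to which \<open>formal_sum\<close> is applied.\<close>

type_synonym pser = "monomial \<Rightarrow> int poly"

definition formal_summable :: "('a \<Rightarrow> pser) \<Rightarrow> 'a set \<Rightarrow> bool" where
  "formal_summable f A \<longleftrightarrow> (\<forall>m. finite {a\<in>A. f a m \<noteq> 0})"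

definition formal_sum :: "('a \<Rightarrow> pser) \<Rightarrow> 'a set \<Rightarrow> pser" where
  "formal_sum f A = (\<lambda>m. \<Sum>a\<in>{a\<in>A. f a m \<noteq> 0}. f a m)"

definition weak_comps_over :: "nat list \<Rightarrow> nat list set" where
  "weak_comps_over \<alpha> = {\<gamma>. trim \<gamma> = \<gamma> \<and> positive_parts \<gamma> = \<alpha>}"

definition quasi_grothendieck :: "nat list \<Rightarrow> pser" where
  "quasi_grothendieck \<alpha> =
     formal_sum (\<lambda>\<gamma>. Poly_Mapping.lookup (lascoux_atom \<gamma>)) (weak_comps_over \<alpha>)"

definition SetRT :: "nat list \<Rightarrow> filling set" where
  "SetRT la = {T. set_filling la T \<and>
     (\<forall>i j. (i, j) \<in> boxes la \<longrightarrow> (i, Suc j) \<in> boxes la \<longrightarrow>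
        Min (T (i, j)) \<ge> Max (T (i, Suc j))) \<and>
     (\<forall>i j. (i, j) \<in> boxes la \<longrightarrow> (Suc i, j) \<in> boxes la \<longrightarrow>
        Min (T (i, j)) > Max (T (Suc i, j)))}"

definition grothendieck :: "nat list \<Rightarrow> pser" where
  "grothendieck la = formal_sum (\<lambda>T. Poly_Mapping.lookup (filling_term la T)) (SetRT la)"

text \<open>The compositions \<open>\<alpha>\<close> with \<open>\<lambda>(\<alpha>) = \<lambda>\<close>, where \<open>\<lambda>\<close> may be given with
  trailing zeros.\<close>

definition rearrangements :: "nat list \<Rightarrow> nat list set" where
  "rearrangements la = {\<alpha>. is_composition \<alpha> \<and> trim (sort_desc \<alpha>) = trim la}"


section \<open>Well-definedness\<close>

lemma boxes_eq: "boxes \<gamma> = (SIGMA i:{1..length \<gamma>}. {1..part \<gamma> i})"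
  by (auto simp: boxes_def part_def split: if_splits)

lemma finite_boxes [simp]: "finite (boxes \<gamma>)"
  by (simp add: boxes_eq)

lemma card_boxes: "card (boxes \<gamma>) = sum_list \<gamma>"
proof -
  have "card (boxes \<gamma>) = (\<Sum>i\<in>{1..length \<gamma>}. part \<gamma> i)"
    by (simp add: boxes_eq)
  also have "\<dots> = (\<Sum>i\<in>{0..<length \<gamma>}. \<gamma> ! i)"
    by (rule sum.reindex_bij_witness[where i = Suc and j = "\<lambda>i. i - 1"])
       (auto simp: part_def)
  finally show ?thesis by (simp add: sum_list_sum_nth)
qed

lemma size_le_num_entries:
  assumes "set_filling \<gamma> F"
  shows "sum_list \<gamma> \<le> num_entries \<gamma> F"
proof -
  have "(\<Sum>b\<in>boxes \<gamma>. 1) \<le> (\<Sum>b\<in>boxes \<gamma>. card (F b))"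
    using assms by (intro sum_mono) (auto simp: set_filling_def Suc_le_eq card_gt_0_iff)
  then show ?thesis by (simp add: num_entries_def card_boxes)
qed

lemma lookup_weight:
  assumes "set_filling \<gamma> F"
  shows "Poly_Mapping.lookup (weight \<gamma> F) i = card {b\<in>boxes \<gamma>. i \<in> F b}"
proof -
  have "Poly_Mapping.lookup (weight \<gamma> F) i =
      (\<Sum>b\<in>boxes \<gamma>. \<Sum>j\<in>F b. if j = i then 1 else 0)"
    by (simp add: weight_def lookup_sum lookup_single when_def del: One_nat_def)
  also have "\<dots> = (\<Sum>b\<in>boxes \<gamma>. if i \<in> F b then 1 else 0)"
    using assms by (intro sum.cong) (auto simp: set_filling_def sum.delta)
  also have "\<dots> = card {b\<in>boxes \<gamma>. i \<in> F b}"
    by (simp add: sum.If_cases Int_def)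
  finally show ?thesis .
qed

lemma entry_in_keys:
  assumes "set_filling \<gamma> F" "b \<in> boxes \<gamma>" "i \<in> F b"
  shows "i \<in> Poly_Mapping.keys (weight \<gamma> F)"
  using assms by (cases b) (auto simp: in_keys_iff lookup_weight card_eq_0_iff)

lemma finite_bounded_fillings:
  assumes "finite X"
  shows "finite {F. set_filling \<gamma> F \<and> (\<forall>b\<in>boxes \<gamma>. F b \<subseteq> X)}"
proof (rule finite_subset)
  show "{F. set_filling \<gamma> F \<and> (\<forall>b\<in>boxes \<gamma>. F b \<subseteq> X)}
      \<subseteq> {F. \<forall>b. (b \<in> boxes \<gamma> \<longrightarrow> F b \<in> Pow X) \<and> (b \<notin> boxes \<gamma> \<longrightarrow> F b = {})}"
    by (auto simp: set_filling_def)
  show "finite {F. \<forall>b. (b \<in> boxes \<gamma> \<longrightarrow> F b \<in> Pow X) \<and> (b \<notin> boxes \<gamma> \<longrightarrow> F b = {})}"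
    using assms by (intro finite_set_of_finite_funs) auto
qed

lemma formal_summable_SetRT:
  "formal_summable (\<lambda>T. Poly_Mapping.lookup (filling_term la T)) (SetRT la)"
  unfolding formal_summable_def
proof
  fix m
  have "{T\<in>SetRT la. Poly_Mapping.lookup (filling_term la T) m \<noteq> 0}
      \<subseteq> {F. set_filling la F \<and> (\<forall>b\<in>boxes la. F b \<subseteq> Poly_Mapping.keys m)}"
    by (auto simp: SetRT_def filling_term_def lookup_single when_def
        dest: entry_in_keys split: if_splits)
  then show "finite {T\<in>SetRT la. Poly_Mapping.lookup (filling_term la T) m \<noteq> 0}"
    by (rule finite_subset) (simp add: finite_bounded_fillings)
qed

lemma SetSkyFill_entry_le:
  assumes F: "F \<in> SetSkyFill \<gamma>"
  shows "(i, Suc k) \<in> boxes \<gamma> \<Longrightarrow> x \<in> F (i, Suc k) \<Longrightarrow> x \<le> i"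
proof (induction k arbitrary: x)
  case 0
  then have "Max (cell F i 1) \<le> Min (cell F i 0)"
    using F by (auto simp: SetSkyFill_def row_decreasing_def)
  moreover have "x \<le> Max (cell F i 1)"
    using 0 F by (auto simp: SetSkyFill_def set_filling_def cell_def intro!: Max_ge)
  ultimately show ?case by (simp add: cell_def)
next
  case (Suc k)
  have b: "(i, Suc k) \<in> boxes \<gamma>" using Suc.prems by (auto simp: boxes_def)
  have "Max (cell F i (Suc (Suc k))) \<le> Min (cell F i (Suc k))"
    using F Suc.prems by (auto simp: SetSkyFill_def row_decreasing_def)
  moreover have "x \<le> Max (cell F i (Suc (Suc k)))"
    using Suc.prems F by (auto simp: SetSkyFill_def set_filling_def cell_def intro!: Max_ge)
  moreover have "finite (F (i, Suc k))" "F (i, Suc k) \<noteq> {}"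
    using F b by (auto simp: SetSkyFill_def set_filling_def)
  then have "Min (cell F i (Suc k)) \<in> F (i, Suc k)"
    by (simp add: cell_def)
  ultimately show ?case using Suc.IH[OF b] by fastforce
qed

lemma finite_SetSkyFill: "finite (SetSkyFill \<gamma>)"
proof (rule finite_subset)
  show "SetSkyFill \<gamma> \<subseteq> {F. set_filling \<gamma> F \<and> (\<forall>b\<in>boxes \<gamma>. F b \<subseteq> {..length \<gamma>})}"
  proof (intro subsetI CollectI conjI ballI)
    fix F assume F: "F \<in> SetSkyFill \<gamma>"
    then show "set_filling \<gamma> F" by (simp add: SetSkyFill_def)
    fix b x assume b: "b \<in> boxes \<gamma>" and x: "x \<in> F b"
    obtain i k where ik: "b = (i, Suc k)" "i \<le> length \<gamma>"
      using b by (cases b; cases "snd b") (auto simp: boxes_eq)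
    then show "x \<in> {..length \<gamma>}"
      using SetSkyFill_entry_le[OF F, of i k x] b x by auto
  qed
qed (simp add: finite_bounded_fillings)

lemma first_column_anchor:
  assumes F: "F \<in> SetSkyFill \<gamma>"
  shows "(j, 1) \<in> boxes \<gamma> \<Longrightarrow> anchor F j 1 = j"
proof (induction j rule: less_induct)
  case (less j)
  have mem: "anchor F i 1 \<in> F (i, 1)" if "(i, 1) \<in> boxes \<gamma>" for i
    using F that by (auto simp: SetSkyFill_def set_filling_def anchor_def cell_def)
  have le: "anchor F j 1 \<le> j"
    using SetSkyFill_entry_le[OF F, of j 0] mem[OF less.prems] less.prems by simp
  have pos: "anchor F j 1 > 0"
    using F mem[OF less.prems] less.prems by (auto simp: SetSkyFill_def set_filling_def)
  have "anchor F j 1 \<noteq> i" if i: "1 \<le> i" "i < j" for i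
  proof (cases "part \<gamma> i = 0")
    case True
    then have "inversion (anchor F j (Suc 0)) (anchor F i 0) (anchor F j 0)"
      using F i less.prems by (auto simp: SetSkyFill_def triples_inversion_def boxes_def)
    then show ?thesis using i by (auto simp: inversion_def anchor_def cell_def)
  next
    case False
    then have b: "(i, 1) \<in> boxes \<gamma>" using i by (simp add: boxes_def)
    have "F (i, 1) \<inter> F (j, 1) = {}"
      using F b less.prems i unfolding SetSkyFill_def column_distinct_def by blast
    then show ?thesis using mem[OF b] mem[OF less.prems] less.IH[OF i(2) b] by auto
  qed
  then show ?case using le pos by (metis One_nat_def Suc_leI le_neq_implies_less)
qed

lemma trim_last:
  assumes "trim \<gamma> = \<gamma>" "\<gamma> \<noteq> []"
  shows "last \<gamma> \<noteq> 0"
proof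
  assume z: "last \<gamma> = 0"
  obtain xs where "\<gamma> = xs @ [0]" using z assms(2) by (metis append_butlast_last_id)
  then have "length (trim \<gamma>) \<le> length xs"
    by (simp add: trim_def) (metis length_dropWhile_le length_rev)
  then show False using assms(1) \<open>\<gamma> = xs @ [0]\<close> by simp
qed

lemma formal_summable_weak_comps_over:
  "formal_summable (\<lambda>\<gamma>. Poly_Mapping.lookup (lascoux_atom \<gamma>)) (weak_comps_over \<alpha>)"
  unfolding formal_summable_def
proof
  fix m :: monomial
  let ?N = "Max (insert 0 (Poly_Mapping.keys m))"
  have "{\<gamma>\<in>weak_comps_over \<alpha>. Poly_Mapping.lookup (lascoux_atom \<gamma>) m \<noteq> 0}
      \<subseteq> {\<gamma>. set \<gamma> \<subseteq> insert 0 (set \<alpha>) \<and> length \<gamma> \<le> ?N}"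
  proof (intro subsetI CollectI conjI)
    fix \<gamma>
    assume "\<gamma> \<in> {\<gamma>\<in>weak_comps_over \<alpha>. Poly_Mapping.lookup (lascoux_atom \<gamma>) m \<noteq> 0}"
    then have g: "trim \<gamma> = \<gamma>" "positive_parts \<gamma> = \<alpha>"
      and nz: "Poly_Mapping.lookup (lascoux_atom \<gamma>) m \<noteq> 0"
      by (auto simp: weak_comps_over_def)
    show "length \<gamma> \<le> ?N"
    proof (cases "\<gamma> = []")
      case False
      from nz obtain F where F: "F \<in> SetSkyFill \<gamma>"
        and "Poly_Mapping.lookup (filling_term \<gamma> F) m \<noteq> 0"
        unfolding lascoux_atom_def lookup_sum by (meson sum.neutral)
      then have m: "weight \<gamma> F = m"
        by (auto simp: filling_term_def lookup_single when_def split: if_splits)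
      have "part \<gamma> (length \<gamma>) \<noteq> 0"
        using trim_last[OF g(1) False] False by (simp add: part_def last_conv_nth Suc_le_eq)
      then have b: "(length \<gamma>, 1) \<in> boxes \<gamma>"
        using False by (simp add: boxes_def Suc_le_eq)
      have sf: "set_filling \<gamma> F" using F by (simp add: SetSkyFill_def)
      have "anchor F (length \<gamma>) 1 \<in> F (length \<gamma>, 1)"
        using sf b by (auto simp: set_filling_def anchor_def cell_def)
      then have "length \<gamma> \<in> Poly_Mapping.keys m"
        using entry_in_keys[OF sf b] first_column_anchor[OF F b] m by simp
      then show ?thesis by simp
    qed simp
    fix a assume "a \<in> set \<gamma>"
    then show "a \<in> insert 0 (set \<alpha>)" using g(2) by (auto simp: positive_parts_def)
  qed
  then show "finite {\<gamma>\<in>weak_comps_over \<alpha>. Poly_Mapping.lookup (lascoux_atom \<gamma>) m \<noteq> 0}"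
    by (rule finite_subset) (simp add: finite_lists_length_le)
qed

lemma trim_composition: "is_composition \<alpha> \<Longrightarrow> trim \<alpha> = \<alpha>"
  unfolding trim_def is_composition_def
  by (subst dropWhile_eq_self_iff[THEN iffD2]) (metis hd_in_set less_irrefl set_rev, simp)

lemma finite_rearrangements: "finite (rearrangements la)"
proof -
  have "rearrangements la \<subseteq> {\<alpha>. set \<alpha> \<subseteq> set (trim la) \<and> length \<alpha> \<le> length (trim la)}"
  proof
    fix \<alpha> assume a: "\<alpha> \<in> rearrangements la"
    then have "is_composition (sort_desc \<alpha>)"
      by (simp add: rearrangements_def is_composition_def sort_desc_def)
    then have "sort_desc \<alpha> = trim la"
      using a trim_composition by (simp add: rearrangements_def)
    then have "set \<alpha> = set (trim la)" "length \<alpha> = length (trim la)"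
      by (metis set_rev set_sort sort_desc_def, metis length_rev length_sort sort_desc_def)
    then show "\<alpha> \<in> {\<alpha>. set \<alpha> \<subseteq> set (trim la) \<and> length \<alpha> \<le> length (trim la)}" by simp
  qed
  then show ?thesis by (rule finite_subset) (simp add: finite_lists_length_le)
qed

lemma part_trim: "part (trim \<gamma>) = part \<gamma>"
proof (induction \<gamma> rule: rev_induct)
  case (snoc a \<gamma>)
  have "part (\<gamma> @ [0]) = part \<gamma>"
    by (auto simp: part_def fun_eq_iff nth_append)
  with snoc show ?case by (cases "a = 0") (simp_all add: trim_def)
qed (simp add: trim_def)

lemma lascoux_atom_trim: "lascoux_atom (trim \<gamma>) = lascoux_atom \<gamma>"
proof -
  have b: "boxes (trim \<gamma>) = boxes \<gamma>" by (simp add: boxes_def part_trim)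
  then have "sum_list (trim \<gamma>) = sum_list \<gamma>" using card_boxes by metis
  then show ?thesis
    by (simp add: lascoux_atom_def SetSkyFill_def filling_term_def weight_def num_entries_def
        set_filling_def column_distinct_def row_decreasing_def triples_inversion_def
        free_entries_highest_def can_be_free_def b part_trim)
qed

end

theory Submission
  imports Defs
begin

text \<open>
  Replace every filling by the sets of anchor entries and the sets of free entries of its
  columns. Let \<open>A\<^sub>k\<close> be the set of anchor entries of column \<open>k\<close>. In both families a free
  entry \<open>x\<close> fits into column \<open>k\<close> if and only if \<open>A\<^sub>k\<close> has more elements above \<open>x\<close> than
  \<open>A\<^bsub>k+1\<^esub>\<close>, and then its row is forced: the highest possible one in a skyline filling,
  the lowest possible one in a reverse tableau.

  The anchor entries are determined by their column sets too. Given that rows decrease, the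
  triple condition says exactly that every column is filled greedily, from its largest entry
  down, with each entry in the highest free row whose left neighbour admits it. The columns of
  a reverse tableau arise from the same rule, started from a basement without constraint
  instead of the basement \<open>b\<^sub>i = i\<close>. So both families are in weight-preserving bijection
  with the same set of pairs of sequences of sets.
\<close>

section \<open>Greedy columns\<close>

text \<open>A column is a function from rows to entries with value 0 where there is no box;
  \<open>R i v\<close> says that the previous column allows the entry \<open>v\<close> in row \<open>i\<close>. With
  \<open>d i = 0 < d r\<close>, the last conjunct forbids leaving an admissible higher row empty.\<close>

definition greedy :: "(nat \<Rightarrow> nat \<Rightarrow> bool) \<Rightarrow> (nat \<Rightarrow> nat) \<Rightarrow> bool" where
  "greedy R d \<longleftrightarrow> inj_on d {i. 0 < d i} \<and> (\<forall>i. 0 < d i \<longrightarrow> R i (d i)) \<and>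
     (\<forall>i r. i < r \<longrightarrow> 0 < d r \<longrightarrow> R i (d r) \<longrightarrow> d r < d i)"

definition vals :: "(nat \<Rightarrow> nat) \<Rightarrow> nat set" where
  "vals d = range d - {0}"

lemma vals_iff: "v \<in> vals d \<longleftrightarrow> 0 < v \<and> (\<exists>i. d i = v)"
  by (auto simp: vals_def)

lemma greedyD:
  assumes "greedy R d"
  shows "0 < d i \<Longrightarrow> R i (d i)" "i < r \<Longrightarrow> 0 < d r \<Longrightarrow> R i (d r) \<Longrightarrow> d r < d i"
    "d i = d r \<Longrightarrow> 0 < d i \<Longrightarrow> i = r"
  using assms by (auto simp: greedy_def inj_on_def)

text \<open>Descending induction on the value: once the rows of all larger values agree, a value
  \<open>v\<close> cannot stand in different rows of the two columns. The higher of these rows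
  admits \<open>v\<close>, so by greediness it holds a larger value in one column and hence, by
  agreement, in both.\<close>

lemma greedy_unique:
  assumes d: "greedy R d" and e: "greedy R e" and eq: "vals d = vals e" and fin: "finite (vals d)"
  shows "d = e"
proof -
  have row: "d r = v \<longleftrightarrow> e r = v" if "0 < v" for v r
    using that
  proof (induction "Suc (Max (vals d)) - v" arbitrary: v r rule: less_induct)
    case less
    have big: "d i = w \<longleftrightarrow> e i = w" if "v < w" for i w
    proof (cases "w \<in> vals d")
      case True
      then have "w \<le> Max (vals d)" using fin by simp
      then have "Suc (Max (vals d)) - w < Suc (Max (vals d)) - v" using that by linarith
      then show ?thesis using less.hyps[of w i] that by simp
    next
      case False
      then have "w \<notin> vals e" using eq by simp
      with False show ?thesis using that unfolding vals_iff by auto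
    qed
    \<comment> \<open>Proved for arbitrary \<open>d\<close> and \<open>e\<close>, because it is
      applied to the two columns in both orders.\<close>
    have aux: "r = s"
      if g: "greedy R d" "greedy R e" and *: "d r = v" "e s = v" "r \<le> s"
        and big: "\<And>i w. v < w \<Longrightarrow> d i = w \<longleftrightarrow> e i = w" for d e r s
    proof (rule ccontr)
      assume "r \<noteq> s"
      then have "r < s" using *(3) by simp
      moreover have "R r v" using greedyD(1)[OF g(1), of r] * less.prems by simp
      ultimately have "v < e r" using greedyD(2)[OF g(2), of r s] * less.prems by simp
      then show False using big[of "e r" r] *(1) by simp
    qed
    have same: "r = s" if *: "d r = v" "e s = v" for r s
    proof (cases "r \<le> s")
      case True
      show ?thesis by (rule aux[OF d e * True big])
    next
      case False
      then have "s \<le> r" by simp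
      then show ?thesis using aux[OF e d *(2,1)] big by metis
    qed
    have "\<exists>s. e s = v" if "d r = v"
      using that less.prems eq vals_iff[of v d] vals_iff[of v e] by blast
    moreover have "\<exists>s. d s = v" if "e r = v"
      using that less.prems eq vals_iff[of v d] vals_iff[of v e] by blast
    ultimately show ?case using same by metis
  qed
  show ?thesis
  proof
    fix i show "d i = e i" using row[of "d i" i] row[of "e i" i] by (cases "d i = 0") auto
  qed
qed

text \<open>The induction inserts the values from the largest down; each goes to the first row that
  admits it and is still empty. The cardinality condition is Hall's condition for this, with a
  separate case for infinitely many rows because \<open>card\<close> of an infinite set is
  0.\<close>

lemma greedy_exists:
  assumes mono: "\<And>i u v. u \<le> v \<Longrightarrow> R i v \<Longrightarrow> R i u"
  shows "finite B \<Longrightarrow> 0 \<notin> B \<Longrightarrow>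
    (\<And>v. v \<in> B \<Longrightarrow> infinite {i. R i v} \<or> card {b\<in>B. v \<le> b} \<le> card {i. R i v}) \<Longrightarrow>
    \<exists>d. greedy R d \<and> vals d = B"
proof (induction B rule: finite_linorder_min_induct)
  case empty
  show ?case by (rule exI[of _ "\<lambda>_. 0"]) (simp add: greedy_def vals_def)
next
  case (insert v B)
  have "\<exists>d. greedy R d \<and> vals d = B"
  proof (rule insert.IH)
    fix u assume "u \<in> B"
    then have "v < u" using insert by simp
    then have "{b \<in> insert v B. u \<le> b} = {b \<in> B. u \<le> b}" by auto
    then show "infinite {i. R i u} \<or> card {b\<in>B. u \<le> b} \<le> card {i. R i u}"
      using insert.prems(2)[of u] \<open>u \<in> B\<close> by simp
  qed (use insert in auto)
  then obtain d where d: "greedy R d" "vals d = B" by blast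
  have v0: "0 < v" using insert by simp
  have dv: "v < d i" if "0 < d i" for i
    using that d(2) insert by (auto simp: vals_def)
  have bij: "bij_betw d {i. 0 < d i} B"
    using d by (auto simp: bij_betw_def greedy_def vals_def)
  have finite_supp: "finite {i. 0 < d i}" using bij insert bij_betw_finite by blast
  \<comment> \<open>The occupied rows are as many as the values in \<open>B\<close>, all of them
    larger than \<open>v\<close>, so the counting condition leaves some admissible row
    empty.\<close>
  have "\<exists>r. R r v \<and> d r = 0"
  proof (cases "finite {i. R i v}")
    case True
    have "{b \<in> insert v B. v \<le> b} = insert v B" using insert by auto
    then have "card (insert v B) \<le> card {i. R i v}" using insert.prems(2)[of v] True by simp
    moreover have "v \<notin> B" using insert by auto
    ultimately have "card {i. 0 < d i} < card {i. R i v}"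
      using bij_betw_same_card[OF bij] insert by simp
    then have "\<not> {i. R i v} \<subseteq> {i. 0 < d i}" using finite_supp card_mono by (metis leD)
    then show ?thesis by auto
  next
    case False
    then have "\<not> {i. R i v} \<subseteq> {i. 0 < d i}" using finite_supp finite_subset by blast
    then show ?thesis by auto
  qed
  then obtain r where r: "R r v" "d r = 0" and r_min: "\<And>i. i < r \<Longrightarrow> R i v \<Longrightarrow> 0 < d i"
    using exists_least_iff[of "\<lambda>r. R r v \<and> d r = 0"] by auto
  have "greedy R (d(r := v))"
    unfolding greedy_def
  proof (intro conjI allI impI)
    show "inj_on (d(r := v)) {i. 0 < (d(r := v)) i}"
    proof (rule inj_onI)
      fix i s assume *: "i \<in> {i. 0 < (d(r := v)) i}" "s \<in> {i. 0 < (d(r := v)) i}"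
        "(d(r := v)) i = (d(r := v)) s"
      then show "i = s"
        using dv[of i] dv[of s] greedyD(3)[OF d(1), of i s] by (auto split: if_splits)
    qed
    show "R i ((d(r := v)) i)" if "0 < (d(r := v)) i" for i
      using that r greedyD(1)[OF d(1)] by auto
    \<comment> \<open>For \<open>s = r\<close> the minimality of \<open>r\<close> applies. For
      \<open>i = r\<close> the premises cannot hold, since greediness of \<open>d\<close> would give
      \<open>d s < d r = 0\<close>.\<close>
    show "(d(r := v)) s < (d(r := v)) i"
      if "i < s" "0 < (d(r := v)) s" "R i ((d(r := v)) s)" for i s
      using that r_min dv greedyD(2)[OF d(1), of i s] r by (auto split: if_splits)
  qed
  moreover have "vals (d(r := v)) = insert v B"
    using d(2) r v0 by (auto simp: vals_def image_iff)
  ultimately show ?case by blast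
qed

text \<open>Turns counts of rows into counts of entries. This makes the existence of a slot depend
  on the column sets alone and not on the rows in which the entries stand.\<close>

lemma card_greater:
  assumes "inj_on d {i. 0 < d i}"
  shows "card {i. x < d i} = card {b \<in> vals d. x < b}"
proof (rule bij_betw_same_card[of d])
  show "bij_betw d {i. x < d i} {b \<in> vals d. x < b}"
    using assms by (auto simp: bij_betw_def vals_def inj_on_def)
qed

section \<open>Fillings determined by the entries of their columns\<close>

text \<open>Fillings number their columns from 1, while here column \<open>Suc k\<close> has index \<open>k\<close>.\<close>

definition lead :: "filling \<Rightarrow> nat \<Rightarrow> nat \<Rightarrow> nat" where
  "lead F k i = (if F (i, Suc k) = {} then 0 else Max (F (i, Suc k)))"

text \<open>\<open>R\<close> plays the role of the basement; every later column is bounded by the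
  anchor entries to its left.\<close>

definition avail :: "(nat \<Rightarrow> nat \<Rightarrow> bool) \<Rightarrow> (nat \<Rightarrow> nat \<Rightarrow> nat) \<Rightarrow> nat \<Rightarrow> nat \<Rightarrow> nat \<Rightarrow> bool" where
  "avail R a k = (case k of 0 \<Rightarrow> R | Suc l \<Rightarrow> \<lambda>i v. v \<le> a l i)"

text \<open>The rows in which \<open>x\<close> can be a free entry of column \<open>Suc k\<close>.\<close>

definition slots :: "(nat \<Rightarrow> nat \<Rightarrow> nat) \<Rightarrow> nat \<Rightarrow> nat \<Rightarrow> nat set" where
  "slots a k x = {r. a (Suc k) r \<le> x \<and> x < a k r}"

text \<open>What the fillings of both families share when no shape is prescribed. Column 0 is empty
  because the basement is not part of a filling.\<close>

definition positive_filling :: "filling \<Rightarrow> bool" where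
  "positive_filling F \<longleftrightarrow> finite {b. F b \<noteq> {}} \<and> (\<forall>b. finite (F b) \<and> 0 \<notin> F b) \<and>
     (\<forall>i. F (i, 0) = {}) \<and> (\<forall>i r j. i \<noteq> r \<longrightarrow> F (i, j) \<inter> F (r, j) = {})"

text \<open>The common form of both families: \<open>R\<close> describes the basement and
  \<open>sel\<close> the choice among the slots. \<open>Min\<close>, the highest row, belongs to
  skyline fillings and \<open>Max\<close>, the lowest one, to reverse tableaux.\<close>

definition placed :: "(nat \<Rightarrow> nat \<Rightarrow> bool) \<Rightarrow> (nat set \<Rightarrow> nat) \<Rightarrow> filling \<Rightarrow> bool" where
  "placed R sel F \<longleftrightarrow> positive_filling F \<and> (\<forall>k. greedy (avail R (lead F) k) (lead F k)) \<and>
     (\<forall>i k x. x \<in> F (i, Suc k) \<longrightarrow> x \<noteq> lead F k i \<longrightarrow>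
        i \<in> slots (lead F) k x \<and> i = sel (slots (lead F) k x))"

definition leads :: "filling \<Rightarrow> nat \<Rightarrow> nat set" where
  "leads F k = vals (lead F k)"

definition frees :: "filling \<Rightarrow> nat \<Rightarrow> nat set" where
  "frees F k = (\<Union>i. F (i, Suc k)) - leads F k"

text \<open>Characterises the pairs \<open>(leads F, frees F)\<close> of placed fillings. The weak
  inequality is Hall's condition for placing the next column of anchor entries; the strict one
  provides a slot for each free entry.\<close>

definition admissible :: "(nat \<Rightarrow> nat set) \<Rightarrow> (nat \<Rightarrow> nat set) \<Rightarrow> bool" where
  "admissible A E \<longleftrightarrow> (\<exists>N. \<forall>k\<ge>N. A k = {}) \<and>
     (\<forall>k. finite (A k) \<and> finite (E k) \<and> 0 \<notin> A k \<and> 0 \<notin> E k \<and> A k \<inter> E k = {} \<and>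
        (\<forall>v. card {b\<in>A (Suc k). v < b} \<le> card {b\<in>A k. v < b}) \<and>
        (\<forall>x\<in>E k. card {b\<in>A (Suc k). x < b} < card {b\<in>A k. x < b}))"

section \<open>Anchor entries and free entries of a column\<close>

lemma same_row: "positive_filling F \<Longrightarrow> x \<in> F (i, j) \<Longrightarrow> x \<in> F (r, j) \<Longrightarrow> i = r"
  by (fastforce simp: positive_filling_def)

lemma lead_in: "positive_filling F \<Longrightarrow> F (i, Suc k) \<noteq> {} \<Longrightarrow> lead F k i \<in> F (i, Suc k)"
  by (simp add: lead_def positive_filling_def)

lemma lead_pos_iff: "positive_filling F \<Longrightarrow> 0 < lead F k i \<longleftrightarrow> F (i, Suc k) \<noteq> {}"
  using lead_in[of F i k] by (metis gr0I lead_def less_irrefl positive_filling_def)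

lemma le_lead: "positive_filling F \<Longrightarrow> x \<in> F (i, Suc k) \<Longrightarrow> x \<le> lead F k i"
  by (auto simp: positive_filling_def lead_def)

lemma finite_lead_supp: "positive_filling F \<Longrightarrow> finite {i. 0 < lead F k i}"
proof -
  assume F: "positive_filling F"
  have "{i. 0 < lead F k i} \<subseteq> fst ` {b. F b \<noteq> {}}"
    using lead_pos_iff[OF F] by (force simp: image_iff)
  moreover have "finite (fst ` {b. F b \<noteq> {}})" using F by (simp add: positive_filling_def)
  ultimately show ?thesis by (rule finite_subset)
qed

lemma lead_inj: "positive_filling F \<Longrightarrow> inj_on (lead F k) {i. 0 < lead F k i}"
proof (rule inj_onI)
  fix i r assume F: "positive_filling F" and i: "i \<in> {i. 0 < lead F k i}"
    and r: "r \<in> {i. 0 < lead F k i}" and eq: "lead F k i = lead F k r"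
  have "lead F k i \<in> F (i, Suc k)" "lead F k r \<in> F (r, Suc k)"
    using lead_in[OF F] lead_pos_iff[OF F] i r by auto
  then show "i = r" using eq same_row[OF F] by simp
qed

lemma finite_leads: "positive_filling F \<Longrightarrow> finite (leads F k)"
proof -
  assume "positive_filling F"
  moreover have "leads F k = lead F k ` {i. 0 < lead F k i}" by (auto simp: leads_def vals_def)
  ultimately show ?thesis using finite_lead_supp by simp
qed

lemma card_leads: "positive_filling F \<Longrightarrow> card (leads F k) = card {i. F (i, Suc k) \<noteq> {}}"
proof -
  assume F: "positive_filling F"
  have "leads F k = {b \<in> vals (lead F k). 0 < b}" by (auto simp: leads_def vals_def)
  then show ?thesis using card_greater[OF lead_inj[OF F], of 0 k] lead_pos_iff[OF F] by simp
qed

text \<open>Since entries do not repeat in a column, a value that is free in one row cannot be the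
  anchor entry of another.\<close>

lemma frees_iff:
  assumes "positive_filling F"
  shows "x \<in> frees F k \<longleftrightarrow> (\<exists>i. x \<in> F (i, Suc k) \<and> x \<noteq> lead F k i)"
proof
  assume "x \<in> frees F k"
  then show "\<exists>i. x \<in> F (i, Suc k) \<and> x \<noteq> lead F k i"
    using assms by (auto simp: frees_def leads_def vals_def positive_filling_def)
next
  assume "\<exists>i. x \<in> F (i, Suc k) \<and> x \<noteq> lead F k i"
  then obtain i where i: "x \<in> F (i, Suc k)" "x \<noteq> lead F k i" by blast
  have "x \<noteq> lead F k r" if "0 < lead F k r" for r
  proof
    assume x: "x = lead F k r"
    then have "x \<in> F (r, Suc k)" using that lead_in[OF assms] lead_pos_iff[OF assms] by simp
    then have "r = i" using i same_row[OF assms] by blast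
    then show False using x i by simp
  qed
  then show "x \<in> frees F k" using i by (auto simp: frees_def leads_def vals_def)
qed

lemma leads_Un_frees: "positive_filling F \<Longrightarrow> leads F k \<union> frees F k = (\<Union>i. F (i, Suc k))"
  using lead_in[of F _ k] lead_pos_iff[of F k] by (force simp: frees_def leads_def vals_def)

lemma eventually_no_leads:
  assumes "positive_filling F"
  shows "\<exists>N. \<forall>k\<ge>N. leads F k = {}"
proof -
  have "finite (snd ` {b. F b \<noteq> {}})" using assms by (simp add: positive_filling_def)
  then obtain N where N: "\<forall>j\<in>snd ` {b. F b \<noteq> {}}. j \<le> N" using finite_nat_set_iff_bounded_le by blast
  have "leads F k = {}" if "N \<le> k" for k
  proof -
    have "F (i, Suc k) = {}" for i using N that by force
    then show ?thesis by (auto simp: leads_def vals_def lead_def)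
  qed
  then show ?thesis by blast
qed

section \<open>Placed fillings correspond to admissible pairs\<close>

lemma placed_greedy:
  assumes "placed R sel F"
  shows "greedy R (lead F 0)" "greedy (\<lambda>i v. v \<le> lead F k i) (lead F (Suc k))"
proof -
  have g: "greedy (avail R (lead F) l) (lead F l)" for l using assms by (simp add: placed_def)
  show "greedy R (lead F 0)" using g[of 0] by (simp add: avail_def)
  show "greedy (\<lambda>i v. v \<le> lead F k i) (lead F (Suc k))" using g[of "Suc k"] by (simp add: avail_def)
qed

lemma placed_free:
  assumes "placed R sel F" "x \<in> F (i, Suc k)" "x \<noteq> lead F k i"
  shows "i \<in> slots (lead F) k x" "i = sel (slots (lead F) k x)"
  using assms unfolding placed_def by blast+

lemma placed_lead_mono: "placed R sel F \<Longrightarrow> lead F (Suc k) i \<le> lead F k i"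
  using greedyD(1)[OF placed_greedy(2), of R sel F k i] by (cases "lead F (Suc k) i = 0") auto

text \<open>Anchor entries decrease along rows, so the set of rows whose anchor entry exceeds
  \<open>v\<close> shrinks from each column to the next. The row of a free entry \<open>x\<close>
  drops out of this set for \<open>v = x\<close>, which makes the inequality strict.\<close>

lemma placed_admissible:
  assumes F: "placed R sel F"
  shows "admissible (leads F) (frees F)"
proof -
  have p: "positive_filling F" using F by (simp add: placed_def)
  have fin: "finite {i. v < lead F k i}" for k v
    by (rule finite_subset[OF _ finite_lead_supp[OF p, of k]]) auto
  have c: "card {b\<in>leads F k. v < b} = card {i. v < lead F k i}" for k v
    using card_greater[OF lead_inj[OF p]] by (simp add: leads_def)
  have sub: "{i. v < lead F (Suc k) i} \<subseteq> {i. v < lead F k i}" for k v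
    using placed_lead_mono[OF F, of k] by (auto intro: less_le_trans)
  have "finite (frees F k)" for k
  proof -
    have "frees F k \<subseteq> (\<Union>i\<in>{i. 0 < lead F k i}. F (i, Suc k))"
      using lead_pos_iff[OF p] by (auto simp: frees_def)
    then show ?thesis using p finite_lead_supp[OF p, of k]
      by (meson finite_UN_I finite_subset positive_filling_def)
  qed
  moreover have "card {b\<in>leads F (Suc k). x < b} < card {b\<in>leads F k. x < b}"
    if x: "x \<in> frees F k" for x k
  proof -
    obtain i where i: "x \<in> F (i, Suc k)" "x \<noteq> lead F k i"
      using x unfolding frees_iff[OF p] by blast
    have "i \<in> slots (lead F) k x" by (rule placed_free(1)[OF F i])
    then have "i \<in> {i. x < lead F k i}" "i \<notin> {i. x < lead F (Suc k) i}" by (simp_all add: slots_def)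
    then have "{i. x < lead F (Suc k) i} \<subset> {i. x < lead F k i}"
      using sub[of x k] by blast
    then have "card {i. x < lead F (Suc k) i} < card {i. x < lead F k i}"
      by (rule psubset_card_mono[OF fin])
    then show ?thesis by (simp only: c)
  qed
  moreover have "card {b\<in>leads F (Suc k). v < b} \<le> card {b\<in>leads F k. v < b}" for v k
    unfolding c by (rule card_mono[OF fin sub])
  moreover have "0 \<notin> frees F k" for k using p by (auto simp: frees_def positive_filling_def)
  moreover have "0 \<notin> leads F k" "leads F k \<inter> frees F k = {}" for k
    by (auto simp: leads_def vals_def frees_def)
  ultimately show ?thesis
    using eventually_no_leads[OF p] finite_leads[OF p] unfolding admissible_def by blast
qed

text \<open>The anchor entries agree column by column, because each column is a greedy one over the
  previous column. They determine the slots, and \<open>sel\<close> then fixes the row of every free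
  entry.\<close>

lemma placed_unique:
  assumes F: "placed R sel F" and H: "placed R sel H"
    and L: "leads F = leads H" and E: "frees F = frees H"
  shows "F = H"
proof -
  have pF: "positive_filling F" and pH: "positive_filling H" using F H by (simp_all add: placed_def)
  have lead: "lead F k = lead H k" for k
  proof (induction k)
    case 0
    have "greedy R (lead F 0)" "greedy R (lead H 0)"
      using F H by (simp_all add: placed_greedy)
    then show ?case
      using greedy_unique[of R "lead F 0" "lead H 0"] finite_leads[OF pF, of 0] L
      by (metis leads_def)
  next
    case (Suc k)
    have "greedy (\<lambda>i v. v \<le> lead F k i) (lead F (Suc k))" "greedy (\<lambda>i v. v \<le> lead F k i) (lead H (Suc k))"
      using placed_greedy(2)[OF F, of k] placed_greedy(2)[OF H, of k] Suc by simp_all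
    then show ?case
      using greedy_unique[of _ "lead F (Suc k)" "lead H (Suc k)"] finite_leads[OF pF, of "Suc k"] L
      by (metis leads_def)
  qed
  have sub: "F (i, Suc k) \<subseteq> H (i, Suc k)"
    if F: "placed R sel F" and H: "placed R sel H" and E: "frees F = frees H"
      and lead: "lead F = lead H" for F H i k
  proof
    have pF: "positive_filling F" and pH: "positive_filling H" using F H by (simp_all add: placed_def)
    fix x assume x: "x \<in> F (i, Suc k)"
    show "x \<in> H (i, Suc k)"
    proof (cases "x = lead F k i")
      case True
      moreover have "0 < lead H k i" using x lead lead_pos_iff[OF pF, of k i] by auto
      ultimately show ?thesis using lead lead_in[OF pH] lead_pos_iff[OF pH] by simp
    next
      case False
      then have i: "i = sel (slots (lead H) k x)" using placed_free(2)[OF F x] lead by simp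
      have "x \<in> frees H k" using False x frees_iff[OF pF] E by auto
      then obtain r where r: "x \<in> H (r, Suc k)" "x \<noteq> lead H k r" using frees_iff[OF pH] by blast
      then have "r = sel (slots (lead H) k x)" by (rule placed_free(2)[OF H])
      then show ?thesis using i r by simp
    qed
  qed
  have "F (i, Suc k) = H (i, Suc k)" for i k
    using sub[OF F H E] sub[OF H F] E lead by (metis ext subset_antisym)
  moreover have "F (i, 0) = H (i, 0)" for i using pF pH by (simp add: positive_filling_def)
  ultimately have "F (i, j) = H (i, j)" for i j by (cases j) auto
  then show ?thesis by auto
qed

text \<open>The columns of anchor entries are built from left to right by
  \<open>greedy_exists\<close>; the first one always fits because \<open>R\<close> admits every
  value in infinitely many rows. Each free entry is then put into the slot chosen by
  \<open>sel\<close>.\<close>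

lemma placed_exists:
  assumes mono: "\<And>i u v. u \<le> v \<Longrightarrow> R i v \<Longrightarrow> R i u" and inf: "\<And>v. infinite {i. R i v}"
    and sel: "\<And>S. finite S \<Longrightarrow> S \<noteq> {} \<Longrightarrow> sel S \<in> S"
    and adm: "admissible A E"
  shows "\<exists>F. placed R sel F \<and> leads F = A \<and> frees F = E"
proof -
  have A: "finite (A k)" "0 \<notin> A k" "finite (E k)" "0 \<notin> E k" "A k \<inter> E k = {}"
    "card {b\<in>A (Suc k). v < b} \<le> card {b\<in>A k. v < b}"
    "x \<in> E k \<Longrightarrow> card {b\<in>A (Suc k). x < b} < card {b\<in>A k. x < b}" for k v x
    using adm by (auto simp: admissible_def)
  obtain N where N: "\<And>k. N \<le> k \<Longrightarrow> A k = {}" using adm unfolding admissible_def by blast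
  \<comment> \<open>Injectivity is carried along because the next column needs it to pass from entry
    counts to row counts; the conjunct for \<open>k = 0\<close> keeps the basement condition of the
    first column.\<close>
  have "\<exists>a. \<forall>k. (vals (a k) = A k \<and> inj_on (a k) {i. 0 < a k i} \<and> (k = 0 \<longrightarrow> greedy R (a k))) \<and>
      greedy (\<lambda>i v. v \<le> a k i) (a (Suc k))"
  proof (rule dependent_nat_choice)
    show "\<exists>d. vals d = A 0 \<and> inj_on d {i. 0 < d i} \<and> (0 = 0 \<longrightarrow> greedy R d)"
    proof -
      have "\<exists>d. greedy R d \<and> vals d = A 0"
        by (rule greedy_exists[OF mono A(1,2)]) (simp_all add: inf)
      then show ?thesis by (auto simp: greedy_def)
    qed
  next
    fix d k assume d: "vals d = A k \<and> inj_on d {i. 0 < d i} \<and> (k = 0 \<longrightarrow> greedy R d)"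
    have "\<exists>e. greedy (\<lambda>i v. v \<le> d i) e \<and> vals e = A (Suc k)"
    proof (rule greedy_exists)
      fix v assume "v \<in> A (Suc k)"
      \<comment> \<open>Admissibility counts the entries above \<open>u\<close>,
        \<open>greedy_exists\<close> those that are at least \<open>v\<close>; the counts agree for
        \<open>v = Suc u\<close>.\<close>
      then obtain u where u: "v = Suc u" using A(2)[of "Suc k"] by (cases v) auto
      show "infinite {i. v \<le> d i} \<or> card {b \<in> A (Suc k). v \<le> b} \<le> card {i. v \<le> d i}"
        using A(6)[where k=k and v=u] card_greater[of d u] d by (simp add: u Suc_le_eq)
    qed (use A in auto)
    then show "\<exists>e. (vals e = A (Suc k) \<and> inj_on e {i. 0 < e i} \<and> (Suc k = 0 \<longrightarrow> greedy R e)) \<and>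
        greedy (\<lambda>i v. v \<le> d i) e"
      by (auto simp: greedy_def)
  qed
  then obtain a where a: "\<And>k. vals (a k) = A k" "\<And>k. inj_on (a k) {i. 0 < a k i}"
    and "greedy R (a 0)" "\<And>k. greedy (\<lambda>i v. v \<le> a k i) (a (Suc k))"
    by auto
  then have greedy: "greedy (avail R a k) (a k)" for k by (cases k) (auto simp: avail_def)
  have fin: "finite {i. 0 < a k i}" for k
  proof -
    have "a k ` {i. 0 < a k i} = A k" using a(1)[of k] by (auto simp: vals_def)
    then show ?thesis using A(1)[of k] a(2)[of k] finite_imageD by metis
  qed
  \<comment> \<open>More rows exceed \<open>x\<close> in column \<open>k\<close> than in the next
    column, so one of them is a slot.\<close>
  have slot: "sel (slots a k x) \<in> slots a k x" if "x \<in> E k" for k x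
  proof (rule sel)
    show "finite (slots a k x)" by (rule finite_subset[OF _ fin[of k]]) (auto simp: slots_def)
    have fin': "finite {i. x < a (Suc k) i}" by (rule finite_subset[OF _ fin[of "Suc k"]]) auto
    have "card {i. x < a (Suc k) i} < card {i. x < a k i}"
      using A(7)[OF that] card_greater[OF a(2)] a(1) by metis
    then have "\<not> {i. x < a k i} \<subseteq> {i. x < a (Suc k) i}" using fin' card_mono by (metis leD)
    then show "slots a k x \<noteq> {}" by (auto simp: slots_def not_less)
  qed
  \<comment> \<open>A box holds its anchor entry, unless \<open>a k i\<close> is the mark 0 of an
    empty box, and the free entries assigned to its row.\<close>
  define F :: filling where
    "F = (\<lambda>(i, j). case j of 0 \<Rightarrow> {} | Suc k \<Rightarrow> ({a k i} - {0}) \<union> {x \<in> E k. i = sel (slots a k x)})"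
  have F: "F (i, Suc k) = ({a k i} - {0}) \<union> {x \<in> E k. i = sel (slots a k x)}" for i k
    by (simp add: F_def)
  \<comment> \<open>Being smaller than \<open>a k i\<close>, a free entry neither stands alone in a
    box nor becomes its maximum.\<close>
  have less: "x < a k i" if "x \<in> E k" "i = sel (slots a k x)" for x k i
    using slot[OF that(1)] that(2) by (simp add: slots_def)
  have ne: "F (i, Suc k) \<noteq> {} \<longleftrightarrow> 0 < a k i" for i k using less by (fastforce simp: F)
  have lead': "lead F k i = a k i" for k i
  proof (cases "0 < a k i")
    case True
    then have "Max (F (i, Suc k)) = a k i"
      by (intro Max_eqI) (use A less in \<open>auto simp: F intro: less_imp_le\<close>)
    then show ?thesis using ne[of i k] True by (simp add: lead_def)
  next
    case False
    then show ?thesis using ne[of i k] by (simp add: lead_def)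
  qed
  then have lead: "lead F = a" by auto
  have notA: "a k i \<notin> E k" if "0 < a k i" for k i
  proof -
    have "a k i \<in> A k" using that a(1)[of k] by (auto simp: vals_def)
    then show ?thesis using A(5)[of k] by auto
  qed
  have p: "positive_filling F"
    unfolding positive_filling_def
  proof (intro conjI allI impI)
    have "{b. F b \<noteq> {}} \<subseteq> (\<Union>k<N. (\<lambda>i. (i, Suc k)) ` {i. 0 < a k i})"
    proof
      fix b assume b: "b \<in> {b. F b \<noteq> {}}"
      then obtain i k where ik: "b = (i, Suc k)" by (cases b; cases "snd b") (auto simp: F_def)
      then have "0 < a k i" using b ne by auto
      moreover from this have "a k i \<in> A k" unfolding a(1)[symmetric] by (auto simp: vals_iff)
      then have "k < N" using N[of k] by (cases "k < N") auto
      ultimately show "b \<in> (\<Union>k<N. (\<lambda>i. (i, Suc k)) ` {i. 0 < a k i})" using ik by auto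
    qed
    then show "finite {b. F b \<noteq> {}}" by (rule finite_subset) (use fin in auto)
    show "finite (F b)" "0 \<notin> F b" for b
      using A(3,4) by (auto simp: F_def split: prod.split nat.split)
    show "F (i, 0) = {}" for i by (simp add: F_def)
    show "F (i, j) \<inter> F (r, j) = {}" if "i \<noteq> r" for i r j
    proof (cases j)
      case (Suc k)
      have "a k i \<noteq> a k r" if "0 < a k i" using a(2)[of k] \<open>i \<noteq> r\<close> that by (auto simp: inj_on_def)
      then show ?thesis using \<open>i \<noteq> r\<close> notA[of k] by (auto simp: Suc F)
    qed (simp add: F_def)
  qed
  have L: "leads F = A" using a(1) by (auto simp: leads_def lead)
  have "placed R sel F"
    unfolding placed_def lead
  proof (intro conjI p allI greedy impI)
    fix i k x assume "x \<in> F (i, Suc k)" "x \<noteq> a k i"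
    then have "x \<in> E k" "i = sel (slots a k x)" by (auto simp: F)
    then show "i \<in> slots a k x" "i = sel (slots a k x)" using slot by auto
  qed
  moreover have "frees F k = E k" for k
  proof -
    have "x \<in> frees F k \<longleftrightarrow> x \<in> E k" for x
      unfolding frees_iff[OF p] lead using notA[of k] A(4)[of k] by (auto simp: F)
        (metis less_irrefl less)
    then show ?thesis by auto
  qed
  ultimately show ?thesis using L by auto
qed

section \<open>Skyline fillings\<close>

lemma box_iff: "(i, Suc k) \<in> boxes \<gamma> \<longleftrightarrow> k < part \<gamma> i"
  by (auto simp: boxes_def part_def)

lemma set_filling_ne: "set_filling \<gamma> F \<Longrightarrow> F (i, Suc k) \<noteq> {} \<longleftrightarrow> k < part \<gamma> i"
  unfolding box_iff[symmetric] set_filling_def by blast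

lemma positive_fillingI:
  assumes F: "set_filling \<gamma> F"
    and disj: "\<And>i r k. i \<noteq> r \<Longrightarrow> k < part \<gamma> i \<Longrightarrow> k < part \<gamma> r \<Longrightarrow> F (i, Suc k) \<inter> F (r, Suc k) = {}"
  shows "positive_filling F"
  unfolding positive_filling_def
proof (intro conjI allI impI)
  have out: "b \<notin> boxes \<gamma> \<Longrightarrow> F b = {}" for b using F unfolding set_filling_def by blast
  show "finite {b. F b \<noteq> {}}" by (rule finite_subset[OF _ finite_boxes[of \<gamma>]]) (use out in auto)
  fix b
  show "finite (F b)" "0 \<notin> F b"
    using F out[of b] unfolding set_filling_def by (metis finite.emptyI empty_iff less_irrefl)+
next
  show *: "F (i, 0) = {}" for i using F by (auto simp: set_filling_def boxes_def)
  fix i r j :: nat assume "i \<noteq> r"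
  then show "F (i, j) \<inter> F (r, j) = {}"
  proof (cases j)
    case (Suc k)
    show ?thesis
    proof (cases "k < part \<gamma> i \<and> k < part \<gamma> r")
      case True
      then show ?thesis using disj \<open>i \<noteq> r\<close> Suc by simp
    next
      case False
      then have "F (i, Suc k) = {} \<or> F (r, Suc k) = {}"
        using set_filling_ne[OF F, of i k] set_filling_ne[OF F, of r k] by blast
      then show ?thesis using Suc by auto
    qed
  qed (simp add: *)
qed

lemma lead_zero: "set_filling \<gamma> F \<Longrightarrow> part \<gamma> i \<le> k \<Longrightarrow> lead F k i = 0"
  using set_filling_ne[of \<gamma> F i k] by (simp add: lead_def)

lemma lead_pos_iff_part:
  "positive_filling F \<Longrightarrow> set_filling \<gamma> F \<Longrightarrow> 0 < lead F k i \<longleftrightarrow> k < part \<gamma> i"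
  by (simp add: lead_pos_iff set_filling_ne)

text \<open>Unlike \<open>lead\<close>, \<open>col\<close> includes the basement as its column 0.\<close>

definition col :: "filling \<Rightarrow> nat \<Rightarrow> nat \<Rightarrow> nat" where
  "col F k i = (case k of 0 \<Rightarrow> i | Suc l \<Rightarrow> lead F l i)"

lemma col_simps [simp]: "col F 0 i = i" "col F (Suc k) i = lead F k i"
  by (simp_all add: col_def)

lemma anchor_col: "set_filling \<gamma> F \<Longrightarrow> k \<le> part \<gamma> i \<Longrightarrow> anchor F i k = col F k i"
  using set_filling_ne[of \<gamma> F i] by (cases k) (auto simp: anchor_def cell_def lead_def Suc_le_eq)

lemma avail_col: "avail (\<lambda>i v. v \<le> i) (lead F) k i v \<longleftrightarrow> v \<le> col F k i"
  by (simp add: avail_def col_def split: nat.split)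

text \<open>The default 0 of \<open>lead\<close> encodes missing boxes: outside the diagram
  \<open>x < 0\<close> fails, and at the end of a row \<open>0 \<le> x\<close> holds for every
  \<open>x\<close>.\<close>

lemma can_be_free_iff_slots:
  assumes F: "set_filling \<gamma> F"
  shows "can_be_free \<gamma> F x r (Suc k) \<longleftrightarrow> r \<in> slots (lead F) k x"
proof (cases "k < part \<gamma> r")
  case True
  have "anchor F r (Suc k) = lead F k r" using anchor_col[OF F, of "Suc k" r] True by simp
  moreover have "(Suc k < part \<gamma> r \<longrightarrow> anchor F r (Suc (Suc k)) \<le> x) \<longleftrightarrow> lead F (Suc k) r \<le> x"
    using anchor_col[OF F, of "Suc (Suc k)" r] lead_zero[OF F, of r "Suc k"]
    by (cases "Suc k < part \<gamma> r") simp_all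
  ultimately show ?thesis using True unfolding can_be_free_def slots_def box_iff by auto
next
  case False
  then show ?thesis using lead_zero[OF F, of r k] by (simp add: can_be_free_def slots_def box_iff)
qed

lemma finite_slots: "positive_filling F \<Longrightarrow> finite (slots (lead F) k x)"
  by (rule finite_subset[OF _ finite_lead_supp[of F k]]) (auto simp: slots_def)

text \<open>An anchor entry bounds its right neighbour by greediness, a free entry because its row
  is a slot.\<close>

lemma placed_row:
  assumes "placed R sel F" "x \<in> F (i, Suc k)"
  shows "lead F (Suc k) i \<le> x"
proof (cases "x = lead F k i")
  case True
  then show ?thesis using placed_lead_mono[OF assms(1), of k i] by simp
next
  case False
  then show ?thesis using placed_free(1)[OF assms] by (simp add: slots_def)
qed

text \<open>Suppose that row \<open>i < r\<close> admits the entry of row \<open>r\<close>. A triple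
  of type A then forces a larger entry in row \<open>i\<close>. Type B cannot occur: row
  \<open>i\<close> is smaller than row \<open>r\<close> in the previous column, so the inversion
  would put the entry of \<open>r\<close> above the bound of row \<open>i\<close>.\<close>

lemma sky_placed:
  assumes "F \<in> SetSkyFill \<gamma>"
  shows "placed (\<lambda>i v. v \<le> i) Min F"
proof -
  from assms have F: "set_filling \<gamma> F" and cd: "column_distinct \<gamma> F"
    and row: "row_decreasing \<gamma> F" and trip: "triples_inversion \<gamma> F"
    and free: "free_entries_highest \<gamma> F"
    by (simp_all add: SetSkyFill_def)
  have p: "positive_filling F"
  proof (rule positive_fillingI[OF F])
    fix i r k assume "i \<noteq> r" "k < part \<gamma> i" "k < part \<gamma> r"
    then show "F (i, Suc k) \<inter> F (r, Suc k) = {}"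
      using cd unfolding column_distinct_def by (simp add: box_iff)
  qed
  \<comment> \<open>For \<open>k = 0\<close> this uses \<open>col F 0 i = i\<close>: even an empty
    row has a positive basement entry, whereas the index 0 is not a row.\<close>
  have colpos: "1 \<le> i \<and> k \<le> part \<gamma> i" if "0 < col F k i" for k i
  proof (cases k)
    case (Suc l)
    then have "l < part \<gamma> i" using that lead_pos_iff_part[OF p F] by simp
    then show ?thesis using Suc by (cases i) (auto simp: part_def)
  qed (use that in simp)
  have mono: "col F (Suc k) i \<le> col F k i" for k i
  proof (cases "k < part \<gamma> i")
    case True
    have "Max (cell F i (Suc k)) \<le> Min (cell F i k)"
      using row True unfolding row_decreasing_def box_iff by blast
    also have "\<dots> \<le> Max (cell F i k)"
    proof (rule Min.coboundedI)
      have fin: "finite (cell F i k)" using p by (simp add: cell_def positive_filling_def)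
      moreover have "cell F i k \<noteq> {}"
        using True set_filling_ne[OF F, of i "k - 1"] by (cases k) (auto simp: cell_def)
      ultimately show "Max (cell F i k) \<in> cell F i k" "finite (cell F i k)" by simp_all
    qed
    finally show ?thesis
      using anchor_col[OF F, of "Suc k" i] anchor_col[OF F, of k i] True by (simp add: anchor_def)
  next
    case False
    then show ?thesis using lead_zero[OF F] by simp
  qed
  have A: "inversion (col F (Suc k) i) (col F (Suc k) r) (col F k i)"
    if "1 \<le> i" "i < r" "part \<gamma> r \<le> part \<gamma> i" "k < part \<gamma> r" for i r k
  proof -
    have "inversion (anchor F i (Suc k)) (anchor F r (Suc k)) (anchor F i k)"
      using trip that unfolding triples_inversion_def by (simp add: Suc_le_eq)
    then show ?thesis using that anchor_col[OF F] by simp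
  qed
  have B: "inversion (col F (Suc k) r) (col F k i) (col F k r)"
    if "1 \<le> i" "i < r" "part \<gamma> i < part \<gamma> r" "k \<le> part \<gamma> i" for i r k
  proof -
    have "inversion (anchor F r (Suc k)) (anchor F i k) (anchor F r k)"
      using trip that unfolding triples_inversion_def by simp
    then show ?thesis using that anchor_col[OF F] by simp
  qed
  \<comment> \<open>The basement has this order, and the triples of type B propagate it to the right.\<close>
  have below: "col F k i < col F k r"
    if "1 \<le> i" "i < r" "part \<gamma> i < part \<gamma> r" "k \<le> part \<gamma> i" for i r k
    using that(4)
  proof (induction k)
    case 0
    then show ?case using that by simp
  next
    case (Suc k)
    then have "col F k i < col F k r" "inversion (col F (Suc k) r) (col F k i) (col F k r)"
      using B[OF that(1-3), of k] by auto
    then show ?case using mono[of k i] by (auto simp: inversion_def)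
  qed
  have greedy: "greedy (avail (\<lambda>i v. v \<le> i) (lead F) k) (lead F k)" for k
    unfolding greedy_def avail_col
  proof (intro conjI allI impI lead_inj[OF p])
    show "lead F k i \<le> col F k i" for i using mono[of k i] by simp
    fix i r assume ir: "i < r" and r: "0 < lead F k r" "lead F k r \<le> col F k i"
    then have i: "1 \<le> i" "k \<le> part \<gamma> i" using colpos[of k i] by auto
    have k: "k < part \<gamma> r" using r lead_pos_iff_part[OF p F] by simp
    show "lead F k r < lead F k i"
    proof (cases "part \<gamma> r \<le> part \<gamma> i")
      case True
      then show ?thesis using A[OF i(1) ir True k] r by (auto simp: inversion_def)
    next
      case False
      then have "part \<gamma> i < part \<gamma> r" by simp
      from B[OF i(1) ir this i(2)] below[OF i(1) ir this i(2)] show ?thesis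
        using r by (auto simp: inversion_def)
    qed
  qed
  have "i \<in> slots (lead F) k x \<and> i = Min (slots (lead F) k x)"
    if x: "x \<in> F (i, Suc k)" "x \<noteq> lead F k i" for i k x
  proof -
    have k: "k < part \<gamma> i" using set_filling_ne[OF F] x by blast
    then have "anchor F i (Suc k) = lead F k i" using anchor_col[OF F, of "Suc k" i] by simp
    then have "can_be_free \<gamma> F x i (Suc k)" "\<forall>r<i. \<not> can_be_free \<gamma> F x r (Suc k)"
      using free x k unfolding free_entries_highest_def by (metis box_iff)+
    then have i: "i \<in> slots (lead F) k x" "\<forall>r<i. r \<notin> slots (lead F) k x"
      by (simp_all add: can_be_free_iff_slots[OF F])
    then have "Min (slots (lead F) k x) = i"
      by (intro Min_eqI finite_slots[OF p]) (auto simp: not_less[symmetric])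
    with i show ?thesis by simp
  qed
  then show ?thesis using p greedy unfolding placed_def by blast
qed

text \<open>In type A, either the entry of the lower row exceeds the one to the left of the upper
  box, or greediness makes the upper entry larger; both cases are inversions. In type B only the
  first case remains, since the second would persist along the shorter row past its end.\<close>

lemma placed_sky:
  assumes pl: "placed (\<lambda>i v. v \<le> i) Min F" and F: "set_filling \<gamma> F"
  shows "F \<in> SetSkyFill \<gamma>"
proof -
  have p: "positive_filling F" using pl by (simp add: placed_def)
  have greedy: "greedy (avail (\<lambda>i v. v \<le> i) (lead F) k) (lead F k)" for k
    using pl unfolding placed_def by blast
  have mono: "lead F k i \<le> col F k i" for k i
    using greedyD(1)[OF greedy, of k i] unfolding avail_col by (cases "lead F k i = 0") auto
  have G: "lead F k r < lead F k i" if "i < r" "k < part \<gamma> r" "lead F k r \<le> col F k i" for i r k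
  proof (rule greedyD(2)[OF greedy that(1)])
    show "0 < lead F k r" using that(2) lead_pos_iff_part[OF p F] by simp
    show "avail (\<lambda>i v. v \<le> i) (lead F) k i (lead F k r)" using that(3) by (simp add: avail_col)
  qed
  have "column_distinct \<gamma> F"
    using p unfolding column_distinct_def positive_filling_def by blast
  moreover have "row_decreasing \<gamma> F"
    unfolding row_decreasing_def
  proof (intro allI impI)
    fix i j assume "(i, Suc j) \<in> boxes \<gamma>"
    then have j: "j < part \<gamma> i" by (simp add: box_iff)
    then have M: "Max (cell F i (Suc j)) = lead F j i"
      using set_filling_ne[OF F, of i j] by (simp add: cell_def lead_def)
    show "Max (cell F i (Suc j)) \<le> Min (cell F i j)"
    proof (cases j)
      case 0
      then show ?thesis unfolding M using mono[of 0 i] by (simp add: cell_def)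
    next
      case (Suc l)
      have "F (i, j) \<noteq> {}" using set_filling_ne[OF F, of i l] j Suc by simp
      moreover have "finite (F (i, j))" using p by (simp add: positive_filling_def)
      ultimately show ?thesis
        unfolding M using placed_row[OF pl, of _ i l] Suc by (simp add: cell_def)
    qed
  qed
  moreover have "triples_inversion \<gamma> F"
    unfolding triples_inversion_def
  proof (intro conjI allI impI)
    fix i r k assume *: "1 \<le> i" "i < r" "part \<gamma> r \<le> part \<gamma> i" "Suc k \<le> part \<gamma> r"
    then have "anchor F i (Suc k) = lead F k i" "anchor F r (Suc k) = lead F k r" "anchor F i k = col F k i"
      using anchor_col[OF F] by simp_all
    then show "inversion (anchor F i (Suc k)) (anchor F r (Suc k)) (anchor F i k)"
      using mono[of k i] G[of i r k] *
      by (cases "lead F k r \<le> col F k i") (simp_all add: inversion_def)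
  next
    fix i r k assume *: "1 \<le> i" "i < r" "part \<gamma> i < part \<gamma> r" "k \<le> part \<gamma> i"
    then have anc: "anchor F r (Suc k) = lead F k r" "anchor F i k = col F k i" "anchor F r k = col F k r"
      using anchor_col[OF F, of "Suc k" r] anchor_col[OF F, of k i] anchor_col[OF F, of k r] by simp_all
    have "col F k i < lead F k r"
    proof (rule ccontr)
      assume "\<not> col F k i < lead F k r"
      \<comment> \<open>\<open>lead F m\<close> is column \<open>m + 1\<close> and
        \<open>col F m\<close> is column \<open>m\<close>. The comparison is carried to the last box
        of row \<open>i\<close>, where greediness would demand one more box in that row.\<close>
      have "lead F m r \<le> col F m i" if "k \<le> m" "m \<le> part \<gamma> i" for m
        using that
      proof (induction m rule: dec_induct)
        case base
        then show ?case using \<open>\<not> col F k i < lead F k r\<close> by simp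
      next
        case (step m)
        have "lead F (Suc m) r \<le> lead F m r" by (rule placed_lead_mono[OF pl])
        also have "\<dots> < lead F m i" using step * by (intro G) auto
        finally show ?case by simp
      qed
      from this[of "part \<gamma> i"] have "lead F (part \<gamma> i) r < lead F (part \<gamma> i) i"
        using * by (intro G) auto
      then show False using lead_zero[OF F, of i "part \<gamma> i"] by simp
    qed
    then show "inversion (anchor F r (Suc k)) (anchor F i k) (anchor F r k)"
      unfolding anc using mono[of k r] by (simp add: inversion_def)
  qed
  moreover have "free_entries_highest \<gamma> F"
    unfolding free_entries_highest_def
  proof (intro allI impI)
    fix i j x assume *: "(i, j) \<in> boxes \<gamma>" "x \<in> F (i, j)" "x \<noteq> anchor F i j"
    then obtain k where k: "j = Suc k" by (cases j) (auto simp: boxes_def)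
    then have "k < part \<gamma> i" using * by (simp add: box_iff)
    then have x: "x \<in> F (i, Suc k)" "x \<noteq> lead F k i" using * k anchor_col[OF F, of "Suc k" i] by auto
    have "r \<notin> slots (lead F) k x" if "r < i" for r
    proof
      assume "r \<in> slots (lead F) k x"
      then have "Min (slots (lead F) k x) \<le> r" by (rule Min_le[OF finite_slots[OF p]])
      then show False using placed_free(2)[OF pl x] that by simp
    qed
    then show "can_be_free \<gamma> F x i j \<and> (\<forall>r<i. \<not> can_be_free \<gamma> F x r j)"
      unfolding k can_be_free_iff_slots[OF F] using placed_free(1)[OF pl x] by blast
  qed
  ultimately show ?thesis using F by (simp add: SetSkyFill_def)
qed

section \<open>Recovering the shape of a placed filling\<close>

lemma positive_filling_entries: "positive_filling F \<Longrightarrow> finite (F b) \<and> (\<forall>x\<in>F b. 0 < x)"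
  unfolding positive_filling_def by (metis gr0I)

text \<open>Applied with \<open>m = 0\<close> to the columns occupied in a row, and with
  \<open>m = 1\<close> to the rows occupied in a column.\<close>

lemma interval_of_downset:
  fixes S :: "nat set"
  assumes "finite S" and S: "\<And>r. r \<in> S \<Longrightarrow> m \<le> r" "\<And>i r. r \<in> S \<Longrightarrow> m \<le> i \<Longrightarrow> i < r \<Longrightarrow> i \<in> S"
  shows "S = {m..<m + card S}"
proof (cases "S = {}")
  case False
  then have M: "Max S \<in> S" using assms(1) by simp
  have "S = {m..Max S}"
  proof
    show "S \<subseteq> {m..Max S}" using S(1) assms(1) by auto
    show "{m..Max S} \<subseteq> S"
    proof
      fix i assume "i \<in> {m..Max S}"
      then show "i \<in> S" using S(2)[OF M, of i] M by (cases "i = Max S") auto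
    qed
  qed
  then obtain n where n: "S = {m..n}" by blast
  have "m \<le> n" using False n by simp
  then have "{m..n} = {m..<m + card {m..n}}" by auto
  then show ?thesis unfolding n .
qed simp

text \<open>Rows are numbered from 1, so index 0 must stay empty: \<open>R\<close> excludes its
  first box, and anchor entries only decrease along a row.\<close>

lemma placed_row0:
  assumes F: "placed R sel F" and R: "\<And>v. 0 < v \<Longrightarrow> \<not> R 0 v"
  shows "F (0, j) = {}"
proof (cases j)
  case 0
  then show ?thesis using F by (simp add: placed_def positive_filling_def)
next
  case (Suc k)
  have "lead F k 0 = 0"
  proof (induction k)
    case 0
    show ?case using greedyD(1)[OF placed_greedy(1)[OF F], of 0] R by (cases "lead F 0 0 = 0") auto
  next
    case (Suc k)
    then show ?case using placed_lead_mono[OF F, of k 0] by simp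
  qed
  moreover have "positive_filling F" using F by (simp add: placed_def)
  ultimately show ?thesis using lead_pos_iff[of F k 0] Suc by simp
qed

text \<open>Anchor entries decrease along rows, so an occupied box has occupied boxes to its left.
  The boxes are therefore left-justified, and the row lengths give the shape.\<close>

lemma placed_shape:
  assumes F: "placed R sel F" and R: "\<And>v. 0 < v \<Longrightarrow> \<not> R 0 v"
  shows "\<exists>\<gamma>. trim \<gamma> = \<gamma> \<and> set_filling \<gamma> F"
proof -
  have p: "positive_filling F" using F by (simp add: placed_def)
  have fin: "finite {b. F b \<noteq> {}}" using p by (simp add: positive_filling_def)
  then have "finite (fst ` {b. F b \<noteq> {}})" by simp
  then obtain N where N: "\<forall>i\<in>fst ` {b. F b \<noteq> {}}. i \<le> N" using finite_nat_set_iff_bounded_le by blast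
  define S where "S i = {k. F (i, Suc k) \<noteq> {}}" for i
  define \<gamma> where "\<gamma> = map (\<lambda>i. card (S i)) [1..<Suc N]"
  have S: "S i = {0..<0 + card (S i)}" for i
  proof (rule interval_of_downset)
    have "S i \<subseteq> (\<lambda>b. snd b - 1) ` {b. F b \<noteq> {}}" by (force simp: S_def image_iff)
    then show "finite (S i)" using fin finite_surj by blast
    show "l \<in> S i" if "k \<in> S i" "l < k" for l k
      using less_imp_le[OF that(2)] that(1)
    proof (induction rule: inc_induct)
      case (step n)
      then have "0 < lead F (Suc n) i" using lead_pos_iff[OF p] by (simp add: S_def)
      then have "0 < lead F n i" using placed_lead_mono[OF F, of n i] by simp
      then show ?case using lead_pos_iff[OF p] by (simp add: S_def)
    qed
  qed simp
  have part: "part \<gamma> i = card (S i)" for i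
  proof (cases "1 \<le> i \<and> i \<le> N")
    case True
    then have "\<gamma> ! (i - 1) = card (S ([1..<Suc N] ! (i - 1)))"
      unfolding \<gamma>_def by (intro nth_map) auto
    also have "[1..<Suc N] ! (i - 1) = i" using True by (subst nth_upt) auto
    finally show ?thesis using True by (simp add: part_def \<gamma>_def del: upt_Suc)
  next
    case False
    have "F (i, Suc k) = {}" for k
    proof (cases "i = 0")
      case True
      then show ?thesis using placed_row0[OF F R] by simp
    next
      case False
      then have "N < i" using \<open>\<not> (1 \<le> i \<and> i \<le> N)\<close> by auto
      then show ?thesis using bspec[OF N, of i] by (auto simp: image_iff)
    qed
    then have "S i = {}" by (simp add: S_def)
    then show ?thesis using False by (auto simp: part_def \<gamma>_def)
  qed
  have ne: "F b \<noteq> {} \<longleftrightarrow> b \<in> boxes \<gamma>" for b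
  proof -
    obtain i j where b: "b = (i, j)" by (cases b)
    show ?thesis
    proof (cases j)
      case 0
      then show ?thesis using b p by (simp add: positive_filling_def boxes_def)
    next
      case (Suc k)
      have "F (i, Suc k) \<noteq> {} \<longleftrightarrow> k \<in> S i" by (simp add: S_def)
      also have "\<dots> \<longleftrightarrow> k < card (S i)" by (subst S) simp
      finally show ?thesis unfolding b Suc box_iff part .
    qed
  qed
  \<comment> \<open>The list built so far may end in zeros; trimming it keeps the boxes and yields
    the chosen representative.\<close>
  have "boxes (trim \<gamma>) = boxes \<gamma>" by (simp add: boxes_def part_trim)
  then have "set_filling (trim \<gamma>) F"
    unfolding set_filling_def using ne positive_filling_entries[OF p] by blast
  moreover have "trim (trim \<gamma>) = trim \<gamma>" by (simp add: trim_def)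
  ultimately show ?thesis by blast
qed

section \<open>Reverse tableaux\<close>

lemma part_antimono:
  assumes "is_partition la" "1 \<le> i" "i \<le> r"
  shows "part la r \<le> part la i"
proof (cases "i < r \<and> r \<le> length la")
  case True
  then have "la ! (r - 1) \<le> la ! (i - 1)"
    using assms unfolding is_partition_def by (intro sorted_wrt_nth_less[of "(\<ge>)" la]) auto
  then show ?thesis using True assms by (simp add: part_def)
qed (use assms in \<open>auto simp: part_def\<close>)

text \<open>Columns of a partition shape have no gaps and decrease strictly, so above every box
  stands a larger anchor entry, which is greediness. A free entry exceeds everything below it in its
  column, so no lower row is a slot for it.\<close>

lemma SetRT_placed:
  assumes la: "is_partition la" and T: "F \<in> SetRT la"
  shows "placed (\<lambda>i v. 1 \<le> i) Max F"
proof -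
  from T have F: "set_filling la F"
    and row: "\<And>i k. Suc k < part la i \<Longrightarrow> Max (F (i, Suc (Suc k))) \<le> Min (F (i, Suc k))"
    and column: "\<And>i k. k < part la i \<Longrightarrow> k < part la (Suc i) \<Longrightarrow> Max (F (Suc i, Suc k)) < Min (F (i, Suc k))"
    by (auto simp: SetRT_def box_iff)
  have fin: "finite (F b)" for b using F unfolding set_filling_def by (metis finite.emptyI)
  have less: "y < x"
    if "1 \<le> i" "i < r" "k < part la r" "x \<in> F (i, Suc k)" "y \<in> F (r, Suc k)" for i r k x y
  proof -
    have step: "y < x" if "1 \<le> i" "k < part la (Suc i)" "x \<in> F (i, Suc k)" "y \<in> F (Suc i, Suc k)" for i x y
    proof -
      have "k < part la i" using part_antimono[OF la that(1), of "Suc i"] that(2) by simp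
      from column[OF this that(2)] show ?thesis
        using Max_ge[OF fin that(4)] Min_le[OF fin that(3)] by simp
    qed
    \<comment> \<open>Induction on the distance of the two rows; the partition shape supplies an
      entry \<open>z\<close> in each row between them.\<close>
    have "y < x" if "k < part la (i + Suc n)" "y \<in> F (i + Suc n, Suc k)" for n y
      using that
    proof (induction n arbitrary: y)
      case 0
      then show ?case using step[OF \<open>1 \<le> i\<close> _ \<open>x \<in> F (i, Suc k)\<close>] by simp
    next
      case (Suc n)
      have k: "k < part la (i + Suc n)"
        using part_antimono[OF la, of "i + Suc n" "i + Suc (Suc n)"] Suc.prems(1) \<open>1 \<le> i\<close> by simp
      then obtain z where z: "z \<in> F (i + Suc n, Suc k)" using set_filling_ne[OF F] by blast
      then have "y < z" using step[of "i + Suc n" z y] Suc.prems by simp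
      also have "z < x" by (rule Suc.IH[OF k z])
      finally show ?case .
    qed
    from this[of "r - Suc i"] show ?thesis using that by simp
  qed
  have part0: "part la 0 = 0" by (simp add: part_def)
  have p: "positive_filling F"
  proof (rule positive_fillingI[OF F])
    fix i r k assume "i \<noteq> r" and k: "k < part la i" "k < part la r"
    then have "1 \<le> i" "1 \<le> r" using part0 by (metis One_nat_def Suc_leI gr0I not_less0)+
    then show "F (i, Suc k) \<inter> F (r, Suc k) = {}"
      using less[of i r k] less[of r i k] k \<open>i \<noteq> r\<close> by (meson disjoint_iff less_irrefl nat_neq_iff)
  qed
  have lead: "0 < lead F k i \<longleftrightarrow> k < part la i" for k i by (rule lead_pos_iff_part[OF p F])
  have lead_in': "lead F k i \<in> F (i, Suc k)" if "k < part la i" for k i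
    by (rule lead_in[OF p]) (use that set_filling_ne[OF F] in simp)
  have row_le: "lead F (Suc k) i \<le> x" if "x \<in> F (i, Suc k)" for i k x
  proof (cases "Suc k < part la i")
    case True
    then have "Max (F (i, Suc (Suc k))) \<le> Min (F (i, Suc k))" by (rule row)
    also have "\<dots> \<le> x" by (rule Min_le[OF fin that])
    finally show ?thesis by (simp add: lead_def)
  next
    case False
    then show ?thesis using lead_zero[OF F] by simp
  qed
  have greedy: "greedy (avail (\<lambda>i v. 1 \<le> i) (lead F) k) (lead F k)" for k
    unfolding greedy_def
  proof (intro conjI allI impI lead_inj[OF p])
    fix i assume i: "0 < lead F k i"
    show "avail (\<lambda>i v. 1 \<le> i) (lead F) k i (lead F k i)"
    proof (cases k)
      case 0
      then show ?thesis using i part0 unfolding lead by (cases i) (auto simp: avail_def)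
    next
      case (Suc l)
      then show ?thesis using row_le[OF lead_in'[of l i]] i unfolding lead by (simp add: avail_def)
    qed
  next
    fix i r assume ir: "i < r" and r: "0 < lead F k r" and av: "avail (\<lambda>i v. 1 \<le> i) (lead F) k i (lead F k r)"
    have i: "1 \<le> i"
    proof (cases k)
      case 0
      then show ?thesis using av by (simp add: avail_def)
    next
      case (Suc l)
      then have "0 < lead F l i" using av r by (simp add: avail_def)
      then show ?thesis using part0 unfolding lead by (cases i) auto
    qed
    have k: "k < part la r" using r unfolding lead .
    then have "k < part la i" using part_antimono[OF la i, of r] ir by simp
    then show "lead F k r < lead F k i" using less[OF i ir k] lead_in' k by blast
  qed
  have "i \<in> slots (lead F) k x \<and> i = Max (slots (lead F) k x)"
    if x: "x \<in> F (i, Suc k)" "x \<noteq> lead F k i" for i k x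
  proof -
    have "x < lead F k i" using le_lead[OF p x(1)] x(2) by simp
    then have i: "i \<in> slots (lead F) k x" using row_le[OF x(1)] by (simp add: slots_def)
    have "1 \<le> i" using set_filling_ne[OF F, of i k] x(1) part0 by (cases i) auto
    have "r \<le> i" if "r \<in> slots (lead F) k x" for r
    proof (rule ccontr)
      assume "\<not> r \<le> i"
      have xr: "x < lead F k r" using that by (simp add: slots_def)
      then have "0 < lead F k r" by simp
      then have "k < part la r" unfolding lead .
      then have "lead F k r < x" using less[OF \<open>1 \<le> i\<close> _ _ x(1) lead_in'] \<open>\<not> r \<le> i\<close> by simp
      then show False using xr by simp
    qed
    then have "Max (slots (lead F) k x) = i" using i by (intro Max_eqI finite_slots[OF p])
    with i show ?thesis by simp
  qed
  then show ?thesis using p greedy unfolding placed_def by blast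
qed

text \<open>Greediness with the unconstrained basement makes the first column strictly decreasing.
  This passes to the right: an entry is at most its left neighbour, which is smaller than the one in
  any higher row, so the higher row admits the entry too. The columns thus have no gaps, and their
  lengths determine the shape.\<close>

lemma placed_SetRT:
  assumes la: "is_partition la" and pl: "placed (\<lambda>i v. 1 \<le> i) Max F"
    and card: "\<And>k. card (leads F k) = card {i. k < part la i}"
  shows "F \<in> SetRT la"
proof -
  have p: "positive_filling F" using pl by (simp add: placed_def)
  have fin: "finite (F b)" for b using p unfolding positive_filling_def by blast
  have strict: "1 \<le> i \<Longrightarrow> i < r \<Longrightarrow> 0 < lead F k r \<Longrightarrow> lead F k r < lead F k i" for i r k
  proof (induction k)
    case 0
    then show ?case using greedyD(2)[OF placed_greedy(1)[OF pl], of i r] by simp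
  next
    case (Suc k)
    have "lead F (Suc k) r \<le> lead F k r" by (rule placed_lead_mono[OF pl])
    then show ?case using greedyD(2)[OF placed_greedy(2)[OF pl], of i r k] Suc by simp
  qed
  have row0: "F (0, j) = {}" for j by (rule placed_row0[OF pl]) simp
  have part0: "part la 0 = 0" by (simp add: part_def)
  \<comment> \<open>Both sets are intervals of rows starting at 1, so equal cardinality makes them
    equal.\<close>
  have "{i. F (i, Suc k) \<noteq> {}} = {i. k < part la i}" for k
  proof -
    have supp: "{i. F (i, Suc k) \<noteq> {}} = {i. 0 < lead F k i}" using lead_pos_iff[OF p] by simp
    have "{i. 0 < lead F k i} = {1..<1 + card {i. 0 < lead F k i}}"
    proof (rule interval_of_downset[OF finite_lead_supp[OF p]])
      show "1 \<le> r" if "r \<in> {i. 0 < lead F k i}" for r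
        using that row0[of "Suc k"] lead_pos_iff[OF p, of k 0] by (cases r) auto
      show "i \<in> {i. 0 < lead F k i}" if "r \<in> {i. 0 < lead F k i}" "1 \<le> i" "i < r" for i r
        using strict[OF that(2,3), of k] that(1) by simp
    qed
    moreover have "{i. k < part la i} = {1..<1 + card {i. k < part la i}}"
    proof (rule interval_of_downset)
      show "finite {i. k < part la i}"
        by (rule finite_subset[of _ "{..length la}"]) (auto simp: part_def split: if_splits)
      show "1 \<le> r" if "r \<in> {i. k < part la i}" for r using that part0 by (cases r) auto
      show "i \<in> {i. k < part la i}" if "r \<in> {i. k < part la i}" "1 \<le> i" "i < r" for i r
        using that part_antimono[OF la that(2), of r] by simp
    qed
    ultimately show ?thesis using card[of k] card_leads[OF p, of k] supp by simp
  qed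
  then have ne: "F (i, Suc k) \<noteq> {} \<longleftrightarrow> k < part la i" for i k by blast
  have F: "set_filling la F"
    unfolding set_filling_def
  proof (intro conjI ballI allI impI)
    show "F b \<noteq> {}" if "b \<in> boxes la" for b
    proof -
      obtain i k where "b = (i, Suc k)" using \<open>b \<in> boxes la\<close> by (cases b; cases "snd b") (auto simp: boxes_def)
      then show ?thesis using \<open>b \<in> boxes la\<close> ne by (simp add: box_iff)
    qed
    show "F b = {}" if "b \<notin> boxes la" for b
    proof (cases "\<exists>i k. b = (i, Suc k)")
      case True
      then show ?thesis using that ne box_iff by blast
    next
      case False
      then have "snd b = 0" by (metis not0_implies_Suc prod.collapse)
      then show ?thesis using p by (cases b) (simp add: positive_filling_def)
    qed
    show "finite (F b)" for b by (rule fin)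
    show "0 < x" if "x \<in> F b" for b x
      using that positive_filling_entries[OF p] by blast
  qed
  have "Max (F (i, Suc (Suc k))) \<le> Min (F (i, Suc k))" if "Suc k < part la i" for i k
  proof -
    have "F (i, Suc k) \<noteq> {}" using ne that by simp
    then have "Min (F (i, Suc k)) \<in> F (i, Suc k)" by (rule Min_in[OF fin])
    from placed_row[OF pl this] show ?thesis using ne[of i "Suc k"] that by (simp add: lead_def)
  qed
  moreover have "Max (F (Suc i, Suc k)) < Min (F (i, Suc k))"
    if k: "k < part la i" "k < part la (Suc i)" for i k
  proof -
    have i: "1 \<le> i" using k(1) part0 by (cases i) auto
    have pos: "0 < lead F k (Suc i)" using k(2) lead_pos_iff_part[OF p F] by simp
    have lt: "lead F k (Suc i) < lead F k i" by (rule strict[OF i _ pos]) simp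
    have "F (i, Suc k) \<noteq> {}" using ne k by simp
    then have min: "Min (F (i, Suc k)) \<in> F (i, Suc k)" (is "?x \<in> _") by (rule Min_in[OF fin])
    \<comment> \<open>If the minimum of the upper box is free and lies below the anchor entry
      underneath, then row \<open>Suc i\<close> is a slot for it as well, against the choice of the
      lowest slot.\<close>
    have "lead F k (Suc i) < ?x"
    proof (cases "?x = lead F k i")
      case True
      then show ?thesis using lt by simp
    next
      case False
      have i_slot: "i \<in> slots (lead F) k ?x" "i = Max (slots (lead F) k ?x)"
        by (rule placed_free[OF pl min False])+
      have ne': "lead F k (Suc i) \<noteq> ?x"
      proof
        assume "lead F k (Suc i) = ?x"
        then have "?x \<in> F (Suc i, Suc k)" using lead_in[OF p, of "Suc i" k] ne k by simp
        from same_row[OF p min this] show False by simp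
      qed
      show ?thesis
      proof (rule ccontr)
        assume "\<not> ?thesis"
        then have "?x < lead F k (Suc i)" using ne' by simp
        moreover have "lead F (Suc k) (Suc i) \<le> ?x"
        proof (cases "0 < lead F (Suc k) (Suc i)")
          case True
          then have "lead F (Suc k) (Suc i) < lead F (Suc k) i" by (rule strict[OF i, rotated]) simp
          then show ?thesis using i_slot(1) by (simp add: slots_def)
        qed simp
        ultimately have "Suc i \<in> slots (lead F) k ?x" by (simp add: slots_def)
        then have "Suc i \<le> Max (slots (lead F) k ?x)" by (rule Max_ge[OF finite_slots[OF p]])
        then show False using i_slot(2) by simp
      qed
    qed
    then show ?thesis using ne[of "Suc i" k] k by (simp add: lead_def)
  qed
  moreover have "\<exists>k. j = Suc k" if "(i, j) \<in> boxes la" for i j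
    using that by (cases j) (auto simp: boxes_def)
  ultimately show ?thesis
    using F unfolding SetRT_def mem_Collect_eq by (intro conjI allI impI) (metis box_iff)+
qed

section \<open>Rearrangements of a partition\<close>

text \<open>These numbers are the column lengths of the diagram, that is, the parts of the conjugate
  partition.\<close>

lemma card_part: "card {i. k < part \<gamma> i} = length (filter (\<lambda>a. k < a) \<gamma>)"
proof -
  have "{i. k < part \<gamma> i} = Suc ` {i. i < length \<gamma> \<and> k < \<gamma> ! i}"
  proof (intro equalityI subsetI)
    fix i assume "i \<in> {i. k < part \<gamma> i}"
    then have "i = Suc (i - 1)" "i - 1 \<in> {i. i < length \<gamma> \<and> k < \<gamma> ! i}"
      by (auto simp: part_def split: if_splits)
    then show "i \<in> Suc ` {i. i < length \<gamma> \<and> k < \<gamma> ! i}" by (rule image_eqI)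
  qed (auto simp: part_def)
  then show ?thesis by (simp add: length_filter_conv_card card_image)
qed

lemma card_leads_part:
  assumes "placed R sel F" "set_filling \<gamma> F"
  shows "card (leads F k) = card {i. k < part \<gamma> i}"
proof -
  have "positive_filling F" using assms(1) by (simp add: placed_def)
  then show ?thesis by (simp add: card_leads set_filling_ne[OF assms(2)])
qed

lemma trim_partition:
  assumes "is_partition la"
  shows "trim la = positive_parts la"
proof -
  have "dropWhile (\<lambda>a. a = 0) xs = filter (\<lambda>a. 0 < a) xs" if "sorted xs" for xs :: "nat list"
    using that
  proof (induction xs)
    case (Cons x xs)
    show ?case
    proof (cases "x = 0")
      case False
      then have "\<forall>a\<in>set xs. 0 < a" using Cons.prems by auto
      then show ?thesis using False by (simp add: filter_True)
    qed (use Cons in simp)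
  qed simp
  moreover have "sorted (rev la)" using assms by (simp add: is_partition_def sorted_wrt_rev)
  ultimately show ?thesis by (simp add: trim_def positive_parts_def rev_filter)
qed

lemma length_filter_Suc:
  "length (filter (\<lambda>a. k < a) xs) = count (mset xs) (Suc k) + length (filter (\<lambda>a. Suc k < a) xs)"
  by (induction xs) auto

lemma length_filter_positive_parts:
  "length (filter (\<lambda>a. k < a) (positive_parts xs)) = length (filter (\<lambda>a. k < a) xs)"
proof -
  have "(\<lambda>a. 0 < a \<and> k < a) = (\<lambda>a. k < a)" by auto
  then show ?thesis by (simp add: positive_parts_def)
qed

text \<open>A partition is determined by its conjugate: the multiplicity of a positive part is the
  difference of two consecutive column lengths.\<close>

lemma mset_positive_parts_eq_iff:
  "mset (positive_parts xs) = mset (positive_parts ys) \<longleftrightarrow>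
     (\<forall>k. length (filter (\<lambda>a. k < a) xs) = length (filter (\<lambda>a. k < a) ys))"
proof
  assume eq: "mset (positive_parts xs) = mset (positive_parts ys)"
  have "length (filter (\<lambda>a. k < a) (positive_parts xs)) = length (filter (\<lambda>a. k < a) (positive_parts ys))" for k
    using arg_cong[OF eq, of "\<lambda>M. size (filter_mset (\<lambda>a. k < a) M)"]
    by (simp only: mset_filter[symmetric] size_mset)
  then show "\<forall>k. length (filter (\<lambda>a. k < a) xs) = length (filter (\<lambda>a. k < a) ys)"
    by (simp add: length_filter_positive_parts)
next
  assume len: "\<forall>k. length (filter (\<lambda>a. k < a) xs) = length (filter (\<lambda>a. k < a) ys)"
  show "mset (positive_parts xs) = mset (positive_parts ys)"
  proof (rule multiset_eqI)
    fix v
    show "count (mset (positive_parts xs)) v = count (mset (positive_parts ys)) v"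
    proof (cases v)
      case 0
      then show ?thesis by (simp add: positive_parts_def)
    next
      case (Suc k)
      have "length (filter (\<lambda>a. j < a) (positive_parts xs)) = length (filter (\<lambda>a. j < a) (positive_parts ys))" for j
        using len by (simp only: length_filter_positive_parts)
      then show ?thesis
        using length_filter_Suc[of k "positive_parts xs"] length_filter_Suc[of k "positive_parts ys"] Suc
        by (metis add_right_cancel)
    qed
  qed
qed

lemma is_composition_positive_parts: "is_composition (positive_parts \<gamma>)"
  by (simp add: is_composition_def positive_parts_def)

lemma rearrangements_iff_mset:
  assumes la: "is_partition la"
  shows "positive_parts \<gamma> \<in> rearrangements la \<longleftrightarrow> mset (positive_parts \<gamma>) = mset (positive_parts la)"
proof -
  have "is_composition (sort_desc (positive_parts \<gamma>))"
    using is_composition_positive_parts[of \<gamma>] by (simp add: is_composition_def sort_desc_def)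
  then have t: "trim (sort_desc (positive_parts \<gamma>)) = rev (sort (positive_parts \<gamma>))"
    using trim_composition by (simp add: sort_desc_def)
  have "sorted (rev (positive_parts la))"
    using la by (simp add: is_partition_def positive_parts_def sorted_wrt_rev sorted_wrt_filter)
  then have "rev (sort (positive_parts \<gamma>)) = positive_parts la
      \<longleftrightarrow> mset (positive_parts \<gamma>) = mset (positive_parts la)"
    by (metis mset_rev mset_sort properties_for_sort rev_rev_ident)
  then show ?thesis
    by (simp add: rearrangements_def is_composition_positive_parts t trim_partition[OF la])
qed

text \<open>Translates the index set of the sum into column lengths, which \<open>leads\<close>
  retains although it forgets the rows.\<close>

lemma rearrangements_iff:
  assumes "is_partition la"
  shows "positive_parts \<gamma> \<in> rearrangements la \<longleftrightarrow>
    (\<forall>k. card {i. k < part \<gamma> i} = card {i. k < part la i})"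
  unfolding rearrangements_iff_mset[OF assms] mset_positive_parts_eq_iff card_part ..

lemma sum_list_rearrangement:
  assumes "is_partition la" "positive_parts \<gamma> \<in> rearrangements la"
  shows "sum_list \<gamma> = sum_list la"
proof -
  have "sum_list (positive_parts xs) = sum_list xs" for xs
    by (induction xs) (auto simp: positive_parts_def)
  then show ?thesis
    using assms rearrangements_iff_mset by (metis sum_mset_sum_list)
qed

text \<open>A nonempty trimmed list ends in a nonzero part, so its length can be read off from
  \<open>part\<close>.\<close>

lemma trimmed_eqI:
  assumes "trim \<gamma> = \<gamma>" "trim \<delta> = \<delta>" "part \<gamma> = part \<delta>"
  shows "\<gamma> = \<delta>"
proof (rule nth_equalityI)
  have le: "length \<gamma> \<le> length \<delta>" if "trim \<gamma> = \<gamma>" "part \<gamma> = part \<delta>" for \<gamma> \<delta>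
  proof (cases "\<gamma> = []")
    case False
    then have "part \<gamma> (length \<gamma>) \<noteq> 0"
      using trim_last[OF that(1)] by (simp add: part_def last_conv_nth Suc_le_eq)
    then show ?thesis unfolding that(2) by (simp add: part_def split: if_splits)
  qed simp
  show len: "length \<gamma> = length \<delta>" using le[of \<gamma> \<delta>] le[of \<delta> \<gamma>] assms by simp
  show "\<gamma> ! i = \<delta> ! i" if "i < length \<gamma>" for i
    using fun_cong[OF assms(3), of "Suc i"] that len by (simp add: part_def)
qed

section \<open>Comparison of coefficients\<close>

text \<open>The exponents of the monomial of a filling, expressed without its shape, since the shape
  varies over the skyline fillings.\<close>

definition occurrences :: "filling \<Rightarrow> nat \<Rightarrow> nat" where
  "occurrences F x = card {b. x \<in> F b}"

text \<open>A value stands in at most one row of a column, so counting boxes amounts to counting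
  columns.\<close>

lemma occurrences_columns:
  assumes p: "positive_filling F"
  shows "occurrences F x = card {k. x \<in> leads F k \<union> frees F k}"
  unfolding occurrences_def
proof (rule bij_betw_same_card)
  show "bij_betw (\<lambda>b. snd b - 1) {b. x \<in> F b} {k. x \<in> leads F k \<union> frees F k}"
    unfolding leads_Un_frees[OF p]
  proof (rule bij_betw_imageI)
    have box: "\<exists>i k. b = (i, Suc k)" if "x \<in> F b" for b
      using that p by (cases b; cases "snd b") (auto simp: positive_filling_def)
    show "inj_on (\<lambda>b. snd b - 1) {b. x \<in> F b}"
    proof (rule inj_onI)
      fix b c assume b: "b \<in> {b. x \<in> F b}" and c: "c \<in> {b. x \<in> F b}" and eq: "snd b - 1 = snd c - 1"
      from b c obtain i k r l where "b = (i, Suc k)" "c = (r, Suc l)" using box by (metis mem_Collect_eq)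
      then show "b = c" using b c eq same_row[OF p] by simp
    qed
    show "(\<lambda>b. snd b - 1) ` {b. x \<in> F b} = {k. x \<in> (\<Union>i. F (i, Suc k))}"
    proof (intro equalityI subsetI)
      fix k assume "k \<in> (\<lambda>b. snd b - 1) ` {b. x \<in> F b}"
      then obtain b where "x \<in> F b" "k = snd b - 1" by blast
      then show "k \<in> {k. x \<in> (\<Union>i. F (i, Suc k))}" using box[of b] by auto
    qed force
  qed
qed

lemma occurrences_eq_iff_weight:
  assumes "set_filling \<gamma> F"
  shows "occurrences F = Poly_Mapping.lookup m \<longleftrightarrow> weight \<gamma> F = m"
proof -
  have "{b. x \<in> F b} = {b \<in> boxes \<gamma>. x \<in> F b}" for x
    using assms unfolding set_filling_def by blast
  then have "occurrences F = Poly_Mapping.lookup (weight \<gamma> F)"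
    using lookup_weight[OF assms] by (simp add: occurrences_def fun_eq_iff)
  then show ?thesis by (simp add: lookup_inject)
qed

definition monomial_degree :: "monomial \<Rightarrow> nat" where
  "monomial_degree m = (\<Sum>x\<in>Poly_Mapping.keys m. Poly_Mapping.lookup m x)"

text \<open>Double counting of pairs of a box and an entry in it. The exponent of \<beta> therefore
  depends only on the monomial and on the size of the shape.\<close>

lemma num_entries_weight:
  assumes F: "set_filling \<gamma> F"
  shows "num_entries \<gamma> F = monomial_degree (weight \<gamma> F)"
proof -
  let ?K = "Poly_Mapping.keys (weight \<gamma> F)"
  have "num_entries \<gamma> F = (\<Sum>b\<in>boxes \<gamma>. \<Sum>x\<in>?K. if x \<in> F b then 1 else 0)"
    unfolding num_entries_def
  proof (rule sum.cong)
    fix b assume "b \<in> boxes \<gamma>"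
    then have "F b = ?K \<inter> {x. x \<in> F b}" using entry_in_keys[OF F, of b] by blast
    then show "card (F b) = (\<Sum>x\<in>?K. if x \<in> F b then 1 else 0)"
      by (simp add: sum.If_cases)
  qed simp
  also have "\<dots> = (\<Sum>x\<in>?K. \<Sum>b\<in>boxes \<gamma>. if x \<in> F b then 1 else 0)" by (rule sum.swap)
  also have "\<dots> = monomial_degree (weight \<gamma> F)"
    by (simp add: monomial_degree_def lookup_weight[OF F] sum.If_cases Int_def)
  finally show ?thesis .
qed

lemma lookup_filling_term:
  assumes "set_filling \<gamma> F"
  shows "Poly_Mapping.lookup (filling_term \<gamma> F) m =
    (if occurrences F = Poly_Mapping.lookup m then \<beta> ^ (monomial_degree m - sum_list \<gamma>) else 0)"
  using num_entries_weight[OF assms]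
  by (auto simp: filling_term_def lookup_single when_def occurrences_eq_iff_weight[OF assms])

lemma beta_nonzero [simp]: "\<beta> \<noteq> 0"
  by (simp add: \<beta>_def)

text \<open>The fillings that contribute to the coefficient of \<open>m\<close>; of the shape only
  the column lengths are prescribed.\<close>

definition placed_over ::
  "(nat \<Rightarrow> nat \<Rightarrow> bool) \<Rightarrow> (nat set \<Rightarrow> nat) \<Rightarrow> nat list \<Rightarrow> monomial \<Rightarrow> filling set" where
  "placed_over R sel la m = {F. placed R sel F \<and>
     (\<forall>k. card (leads F k) = card {i. k < part la i}) \<and> occurrences F = Poly_Mapping.lookup m}"

text \<open>Sending a filling to its anchor sets and free sets is a bijection onto a set in which
  neither \<open>R\<close> nor \<open>sel\<close> occurs; this allows the two families to be
  compared.\<close>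

lemma card_placed_over:
  assumes R: "\<And>i u v. u \<le> v \<Longrightarrow> R i v \<Longrightarrow> R i u" "\<And>v. infinite {i. R i v}"
    and sel: "\<And>S. finite S \<Longrightarrow> S \<noteq> {} \<Longrightarrow> sel S \<in> S"
  shows "card (placed_over R sel la m) = card {(A, E). admissible A E \<and>
    (\<forall>k. card (A k) = card {i. k < part la i}) \<and>
    (\<forall>x. card {k. x \<in> A k \<union> E k} = Poly_Mapping.lookup m x)}" (is "_ = card ?D")
proof (rule bij_betw_same_card)
  let ?f = "\<lambda>F. (leads F, frees F)"
  have c: "occurrences F = Poly_Mapping.lookup m \<longleftrightarrow>
      (\<forall>x. card {k. x \<in> leads F k \<union> frees F k} = Poly_Mapping.lookup m x)" if "placed R sel F" for F
  proof -
    have "positive_filling F" using that by (simp add: placed_def)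
    then show ?thesis by (simp add: fun_eq_iff occurrences_columns)
  qed
  show "bij_betw ?f (placed_over R sel la m) ?D"
  proof (rule bij_betw_imageI)
    show "inj_on ?f (placed_over R sel la m)"
    proof (rule inj_onI)
      fix F H assume "F \<in> placed_over R sel la m" "H \<in> placed_over R sel la m" "?f F = ?f H"
      then show "F = H" using placed_unique[of R sel F H] by (simp add: placed_over_def)
    qed
    show "?f ` placed_over R sel la m = ?D"
    proof (intro equalityI subsetI)
      fix D assume "D \<in> ?f ` placed_over R sel la m"
      then obtain F where D: "D = ?f F" and F: "F \<in> placed_over R sel la m" by blast
      then have "placed R sel F" by (simp add: placed_over_def)
      then show "D \<in> ?D" using F c[of F] placed_admissible[of R sel F] unfolding D placed_over_def by simp
    next
      fix D assume "D \<in> ?D"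
      then obtain A E where D: "D = (A, E)" and AE: "admissible A E"
        "\<forall>k. card (A k) = card {i. k < part la i}"
        "\<forall>x. card {k. x \<in> A k \<union> E k} = Poly_Mapping.lookup m x" by blast
      have "\<exists>F. placed R sel F \<and> leads F = A \<and> frees F = E"
        by (rule placed_exists[OF _ R(2) _ AE(1)], fact R(1), fact sel)
      then obtain F where F: "placed R sel F" "leads F = A" "frees F = E" by blast
      then have "F \<in> placed_over R sel la m" using AE c[OF F(1)] by (simp add: placed_over_def)
      then show "D \<in> ?f ` placed_over R sel la m" using F D by blast
    qed
  qed
qed

lemma card_placed_over_eq:
  "card (placed_over (\<lambda>i v. 1 \<le> i) Max la m) = card (placed_over (\<lambda>i v. v \<le> i) Min la m)"
proof -
  have inf: "infinite {i. v \<le> i}" for v :: nat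
    using infinite_Ici[of v] by (simp add: atLeast_def)
  show ?thesis
    by (subst (1 2) card_placed_over) (auto simp: inf[simplified] intro: Max_in Min_in)
qed

section \<open>Coefficients of the two sides\<close>

lemma SetRT_placed_over:
  assumes "is_partition la"
  shows "{T \<in> SetRT la. occurrences T = Poly_Mapping.lookup m} = placed_over (\<lambda>i v. 1 \<le> i) Max la m"
proof -
  have "card (leads T k) = card {i. k < part la i}" if "T \<in> SetRT la" for T k
    using card_leads_part[OF SetRT_placed[OF assms that]] that by (simp add: SetRT_def)
  then show ?thesis
    unfolding placed_over_def using SetRT_placed[OF assms] placed_SetRT[OF assms] by blast
qed

lemma grothendieck_card:
  assumes la: "is_partition la"
  shows "grothendieck la m =
    of_nat (card (placed_over (\<lambda>i v. 1 \<le> i) Max la m)) * \<beta> ^ (monomial_degree m - sum_list la)"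
proof -
  have l: "Poly_Mapping.lookup (filling_term la T) m =
      (if occurrences T = Poly_Mapping.lookup m then \<beta> ^ (monomial_degree m - sum_list la) else 0)"
    if "T \<in> SetRT la" for T
    using that lookup_filling_term by (simp add: SetRT_def)
  have "{T \<in> SetRT la. Poly_Mapping.lookup (filling_term la T) m \<noteq> 0}
      = {T \<in> SetRT la. occurrences T = Poly_Mapping.lookup m}"
    by (intro Collect_cong conj_cong refl) (simp add: l)
  then have "grothendieck la m = (\<Sum>T\<in>{T \<in> SetRT la. occurrences T = Poly_Mapping.lookup m}.
      \<beta> ^ (monomial_degree m - sum_list la))"
    unfolding grothendieck_def formal_sum_def by (intro sum.cong) (simp_all add: l)
  then show ?thesis by (simp add: SetRT_placed_over[OF la])
qed

lemma lookup_lascoux_atom: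
  "Poly_Mapping.lookup (lascoux_atom \<gamma>) m =
    of_nat (card {F \<in> SetSkyFill \<gamma>. occurrences F = Poly_Mapping.lookup m}) * \<beta> ^ (monomial_degree m - sum_list \<gamma>)"
proof -
  have "Poly_Mapping.lookup (lascoux_atom \<gamma>) m = (\<Sum>F\<in>SetSkyFill \<gamma>.
      if occurrences F = Poly_Mapping.lookup m then \<beta> ^ (monomial_degree m - sum_list \<gamma>) else 0)"
    unfolding lascoux_atom_def lookup_sum
    by (intro sum.cong refl lookup_filling_term) (simp add: SetSkyFill_def)
  then show ?thesis by (simp add: sum.If_cases finite_SetSkyFill Int_def)
qed

lemma SetSkyFill_disjoint:
  assumes "trim \<gamma> = \<gamma>" "trim \<delta> = \<delta>" "F \<in> SetSkyFill \<gamma>" "F \<in> SetSkyFill \<delta>"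
  shows "\<gamma> = \<delta>"
proof (rule trimmed_eqI[OF assms(1,2)])
  have F: "set_filling \<gamma> F" "set_filling \<delta> F" using assms by (simp_all add: SetSkyFill_def)
  have "k < part \<gamma> i \<longleftrightarrow> k < part \<delta> i" for k i
    using set_filling_ne[OF F(1)] set_filling_ne[OF F(2)] by blast
  then show "part \<gamma> = part \<delta>" by (metis ext less_irrefl linorder_neqE_nat)
qed

theorem corollary1p4:
  fixes la :: "nat list"
  assumes "is_partition la"
  shows "grothendieck la = (\<lambda>m. \<Sum>\<alpha>\<in>rearrangements la. quasi_grothendieck \<alpha> m)"
proof
  fix m
  let ?L = "\<lambda>\<gamma>. Poly_Mapping.lookup (lascoux_atom \<gamma>) m"
  let ?S = "\<lambda>\<gamma>. {F \<in> SetSkyFill \<gamma>. occurrences F = Poly_Mapping.lookup m}"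
  \<comment> \<open>Collects the shapes that contribute to the coefficient of \<open>m\<close> over
    all rearrangements at once, so that the double sum becomes a single finite one.\<close>
  define \<Gamma> where "\<Gamma> = {\<gamma>. trim \<gamma> = \<gamma> \<and> positive_parts \<gamma> \<in> rearrangements la \<and> ?L \<gamma> \<noteq> 0}"
  have fiber: "{\<gamma> \<in> weak_comps_over \<alpha>. ?L \<gamma> \<noteq> 0} = {\<gamma> \<in> \<Gamma>. positive_parts \<gamma> = \<alpha>}"
    if "\<alpha> \<in> rearrangements la" for \<alpha>
    using that by (auto simp: \<Gamma>_def weak_comps_over_def)
  have "\<Gamma> = (\<Union>\<alpha>\<in>rearrangements la. {\<gamma> \<in> weak_comps_over \<alpha>. ?L \<gamma> \<noteq> 0})"
    by (auto simp: \<Gamma>_def weak_comps_over_def)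
  moreover have "finite {\<gamma> \<in> weak_comps_over \<alpha>. ?L \<gamma> \<noteq> 0}" for \<alpha>
    using formal_summable_weak_comps_over[of \<alpha>] by (simp add: formal_summable_def)
  ultimately have fin: "finite \<Gamma>" by (simp add: finite_rearrangements)
  have "(\<Sum>\<alpha>\<in>rearrangements la. quasi_grothendieck \<alpha> m)
      = (\<Sum>\<alpha>\<in>rearrangements la. \<Sum>\<gamma>\<in>{\<gamma> \<in> \<Gamma>. positive_parts \<gamma> = \<alpha>}. ?L \<gamma>)"
    unfolding quasi_grothendieck_def formal_sum_def by (intro sum.cong refl fiber)
  also have "\<dots> = (\<Sum>\<gamma>\<in>\<Gamma>. ?L \<gamma>)"
    by (intro sum.group fin finite_rearrangements) (auto simp: \<Gamma>_def)
  also have "\<dots> = (\<Sum>\<gamma>\<in>\<Gamma>. of_nat (card (?S \<gamma>)) * \<beta> ^ (monomial_degree m - sum_list la))"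
    by (intro sum.cong refl)
       (auto simp: \<Gamma>_def lookup_lascoux_atom sum_list_rearrangement[OF assms])
  also have "\<dots> = of_nat (\<Sum>\<gamma>\<in>\<Gamma>. card (?S \<gamma>)) * \<beta> ^ (monomial_degree m - sum_list la)"
    by (simp add: sum_distrib_right)
  \<comment> \<open>A filling determines its trimmed shape, so the sets for different shapes are
    disjoint.\<close>
  also have "(\<Sum>\<gamma>\<in>\<Gamma>. card (?S \<gamma>)) = card (\<Union>\<gamma>\<in>\<Gamma>. ?S \<gamma>)"
  proof (rule card_UN_disjoint[symmetric])
    show "\<forall>\<gamma>\<in>\<Gamma>. \<forall>\<delta>\<in>\<Gamma>. \<gamma> \<noteq> \<delta> \<longrightarrow> ?S \<gamma> \<inter> ?S \<delta> = {}"
      using SetSkyFill_disjoint unfolding \<Gamma>_def by blast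
  qed (simp_all add: fin finite_SetSkyFill)
  also have "(\<Union>\<gamma>\<in>\<Gamma>. ?S \<gamma>) = placed_over (\<lambda>i v. v \<le> i) Min la m"
  proof (intro equalityI subsetI)
    fix F assume "F \<in> (\<Union>\<gamma>\<in>\<Gamma>. ?S \<gamma>)"
    then obtain \<gamma> where \<gamma>: "positive_parts \<gamma> \<in> rearrangements la" and F: "F \<in> SetSkyFill \<gamma>"
      and c: "occurrences F = Poly_Mapping.lookup m" unfolding \<Gamma>_def by blast
    have pl: "placed (\<lambda>i v. v \<le> i) Min F" by (rule sky_placed[OF F])
    have "card (leads F k) = card {i. k < part \<gamma> i}" for k
      using card_leads_part[OF pl] F by (simp add: SetSkyFill_def)
    then show "F \<in> placed_over (\<lambda>i v. v \<le> i) Min la m"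
      using pl c \<gamma> unfolding rearrangements_iff[OF assms] placed_over_def by simp
  next
    fix F assume "F \<in> placed_over (\<lambda>i v. v \<le> i) Min la m"
    then have pl: "placed (\<lambda>i v. v \<le> i) Min F" and c: "occurrences F = Poly_Mapping.lookup m"
      and card: "\<And>k. card (leads F k) = card {i. k < part la i}"
      by (simp_all add: placed_over_def)
    obtain \<gamma> where \<gamma>: "trim \<gamma> = \<gamma>" "set_filling \<gamma> F"
      using placed_shape[OF pl] by auto
    have F: "F \<in> ?S \<gamma>" using placed_sky[OF pl \<gamma>(2)] c by simp
    have "card (leads F k) = card {i. k < part \<gamma> i}" for k
      by (rule card_leads_part[OF pl \<gamma>(2)])
    then have "positive_parts \<gamma> \<in> rearrangements la"
      unfolding rearrangements_iff[OF assms] using card by simp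
    \<comment> \<open>All fillings of one shape contribute the same power of \<beta> to this
      coefficient, so nothing cancels: a single filling puts its shape into \<Gamma>.\<close>
    moreover have "card (?S \<gamma>) \<noteq> 0" using F finite_SetSkyFill[of \<gamma>] by auto
    then have "?L \<gamma> \<noteq> 0" unfolding lookup_lascoux_atom by simp
    ultimately show "F \<in> (\<Union>\<gamma>\<in>\<Gamma>. ?S \<gamma>)" using F \<gamma>(1) unfolding \<Gamma>_def by blast
  qed
  finally show "grothendieck la m = (\<Sum>\<alpha>\<in>rearrangements la. quasi_grothendieck \<alpha> m)"
    by (simp only: grothendieck_card[OF assms] card_placed_over_eq)
qed

end
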